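(* Assume that $f_T$ and $f_Y$ are bounded above by a finite constant, $D^2>0$, $\mathsf{E}(T^3)<\infty$, and $\mathsf{E}(Y^3)<\infty$. Then for $t\to\infty$, $$u_{\alpha,t}(0)=\frac{t}{M}+\frac{D}{M^{3/2}}\,\kappa_\alpha\sqrt t\,\big(1+o(1)\big).$$
   Context: $T_1,T_2,\dots$ are i.i.d. positive random variables distributed as $T$, with density $f_T$; $Y_1,Y_2,\dots$ are i.i.d. positive random variables distributed as $Y$, with density $f_Y$; the two sequences are independent. Renewal process: $N_s=\max\{n\ge 1:\sum_{i=1}^nT_i\le s\}$, with $N_s=0$ if $T_1>s$. Compound renewal process: $V_s=\sum_{i=1}^{N_s}Y_i$, with $V_s=0$ if $T_1>s$. For $u,c\ge 0$, $\Upsilon_{u,c}=\inf\{s>0:V_s-cs>u\}$, with $\Upsilon_{u,c}=+\infty$ if $V_s-cs\le u$ for all $s>0$. Fixed $\alpha\in(0,1/2)$. The fixed-probability level $u_{\alpha,t}(c)$, $c\ge0$, is the solution, with respect to $u\geq 0$, of the equation $\mathsf{P}\{\Upsilon_{u,c}\le t\}=\alpha$. Constants ($\mathsf{D}$ denotes variance): $M=\mathsf{E}T/\mathsf{E}Y$, $D^2=\big((\mathsf{E}T)^2\,\mathsf{D}Y+(\mathsf{E}Y)^2\,\mathsf{D}T\big)/(\mathsf{E}Y)^3$, $D>0$. $\kappa_\beta$ is the upper $\beta$-quantile of the standard normal distribution: $1-\Phi(\kappa_\beta)=\beta$, where $\Phi$ is the standard normal c.d.f. *)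

theory Defs
  imports "HOL-Probability.Probability"
begin

text \<open>
  Sequences are indexed from 0: the variables \<open>T\<^sub>1, T\<^sub>2, \<dots>\<close> of the mathematical text
  are \<open>T 0, T 1, \<dots>\<close>, and likewise for \<open>Y\<close>. Thus the sum of the first \<open>n\<close> variables
  is the sum over \<open>i < n\<close>.
\<close>

definition renewal_count :: "(nat \<Rightarrow> 'a \<Rightarrow> real) \<Rightarrow> real \<Rightarrow> 'a \<Rightarrow> nat" where
  "renewal_count T s \<omega> =
     (if T 0 \<omega> > s then 0 else Max {n. 1 \<le> n \<and> (\<Sum>i<n. T i \<omega>) \<le> s})"

text \<open>
  For positive i.i.d. variables the set under \<^const>\<open>Max\<close> is almost surely finite. On the
  exceptional null event \<^const>\<open>Max\<close> of an infinite set is an unspecified constant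
  that does not depend on the outcome.
\<close>

definition compound_renewal ::
    "(nat \<Rightarrow> 'a \<Rightarrow> real) \<Rightarrow> (nat \<Rightarrow> 'a \<Rightarrow> real) \<Rightarrow> real \<Rightarrow> 'a \<Rightarrow> real" where
  "compound_renewal T Y s \<omega> = (\<Sum>i<renewal_count T s \<omega>. Y i \<omega>)"

text \<open>The infimum is taken in the extended reals, where \<open>Inf {} = \<infinity>\<close>.\<close>

definition ruin_time ::
    "(nat \<Rightarrow> 'a \<Rightarrow> real) \<Rightarrow> (nat \<Rightarrow> 'a \<Rightarrow> real) \<Rightarrow> real \<Rightarrow> real \<Rightarrow> 'a \<Rightarrow> ereal" where
  "ruin_time T Y u c \<omega> =
     Inf (ereal ` {s. 0 < s \<and> compound_renewal T Y s \<omega> - c * s > u})"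

text \<open>
  A definite description: a statement about \<open>fixed_prob_level P T Y \<alpha> t c\<close> has content
  only where the equation has exactly one solution. For small \<open>t\<close> there may be none.
\<close>

definition fixed_prob_level ::
    "'a measure \<Rightarrow> (nat \<Rightarrow> 'a \<Rightarrow> real) \<Rightarrow> (nat \<Rightarrow> 'a \<Rightarrow> real) \<Rightarrow> real \<Rightarrow> real \<Rightarrow> real \<Rightarrow> real" where
  "fixed_prob_level P T Y \<alpha> t c =
     (THE u. 0 \<le> u \<and> measure P {\<omega> \<in> space P. ruin_time T Y u c \<omega> \<le> ereal t} = \<alpha>)"

definition mean_ratio :: "'a measure \<Rightarrow> ('a \<Rightarrow> real) \<Rightarrow> ('a \<Rightarrow> real) \<Rightarrow> real" where
  "mean_ratio P X Z = prob_space.expectation P X / prob_space.expectation P Z"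

text \<open>This is \<open>D\<^sup>2\<close>. The constant \<open>D\<close> itself is its positive square root.\<close>

definition D_squared :: "'a measure \<Rightarrow> ('a \<Rightarrow> real) \<Rightarrow> ('a \<Rightarrow> real) \<Rightarrow> real" where
  "D_squared P X Z =
     ((prob_space.expectation P X)\<^sup>2 * prob_space.variance P Z
        + (prob_space.expectation P Z)\<^sup>2 * prob_space.variance P X)
      / (prob_space.expectation P Z) ^ 3"

definition upper_normal_quantile :: "real \<Rightarrow> real" where
  "upper_normal_quantile \<beta> = (THE x. 1 - cdf std_normal_distribution x = \<beta>)"

end

theory Submission
  imports Defs
begin

text \<open>
  With \<open>c = 0\<close> the process \<open>V\<close> is nondecreasing and right-constant, so ruin before \<open>t\<close> means
  \<open>V t > u\<close> up to a null event. Put \<open>ratio = E Y / E T\<close> and \<open>Z i = Y i - ratio * T i\<close>, a centred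
  i.i.d. sequence. On the scale \<open>sqrt t\<close>, \<open>V t - ratio * t\<close> differs negligibly from the sum of the
  first \<open>t / E T\<close> variables \<open>Z i\<close>, because the partial sums of \<open>T\<close> and of \<open>Y\<close> are monotone and
  their increments over \<open>O(sqrt t)\<close> indices are deterministic up to \<open>o(sqrt t)\<close>. The central limit
  theorem for \<open>Z\<close> then squeezes every solution of the defining equation between
  \<open>ratio * t + l * sqrt t\<close> and \<open>ratio * t + h * sqrt t\<close> for all \<open>l\<close>, \<open>h\<close> around the limit.

  The level is a definite description, so the solution must also be shown to exist and to be unique.
  Existence holds since \<open>V t\<close> has no atoms in the positive half-line. For uniqueness, \<open>V t\<close> must
  charge every interval near \<open>ratio * t\<close>: the support of \<open>Y\<close> has positive Lebesgue measure and
  points on both sides of \<open>E Y\<close>, so by Steinhaus' theorem its \<open>n\<close>-fold sumset covers an interval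
  around \<open>n * E Y\<close> of length proportional to \<open>n\<close>.
\<close>

subsection \<open>The standard normal distribution function\<close>

text \<open>A law with a density has no atoms. Weak convergence controls distribution functions only
  at continuity points of the limit, so this makes the central limit theorem usable at every
  point.\<close>

lemma isCont_cdf_std_normal: "isCont (cdf std_normal_distribution) x"
proof -
  interpret real_distribution std_normal_distribution
    by (rule real_dist_normal_dist)
  have "emeasure std_normal_distribution {x} = 0"
    by (subst emeasure_density) (auto intro!: nn_integral_null_delta null_setsI simp: nn_integral_indicator_singleton)
  then show ?thesis
    by (simp add: isCont_cdf measure_def)
qed

text \<open>The density is positive everywhere, so an interval of probability zero would be a
  Lebesgue null set.\<close>

lemma cdf_std_normal_strict_mono: "strict_mono (cdf std_normal_distribution)"
proof (rule strict_monoI)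
  fix x y :: real assume "x < y"
  interpret real_distribution std_normal_distribution
    by (rule real_dist_normal_dist)
  have "emeasure std_normal_distribution {x<..y} \<noteq> 0"
  proof
    assume "emeasure std_normal_distribution {x<..y} = 0"
    then have "{x<..y} \<in> null_sets std_normal_distribution"
      by (auto intro!: null_setsI)
    then have "AE z in lborel. z \<in> {x<..y} \<longrightarrow> ennreal (std_normal_density z) = 0"
      by (subst (asm) null_sets_density_iff) auto
    then have "AE z in lborel. z \<notin> {x<..y}"
      by eventually_elim (use normal_density_pos[of 1 0] in \<open>auto simp: ennreal_eq_0_iff simp flip: not_less\<close>)
    then have "emeasure lborel {x<..y} = 0"
      by (subst (asm) AE_iff_measurable[where N="{x<..y}"]) auto
    with \<open>x < y\<close> show False by simp
  qed
  then have "measure std_normal_distribution {x<..y} > 0"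
    by (simp add: emeasure_eq_measure zero_less_measure_iff)
  then show "cdf std_normal_distribution x < cdf std_normal_distribution y"
    using cdf_diff_eq[OF \<open>x < y\<close>] by simp
qed

text \<open>Reflection at 0 preserves the density and exchanges the two closed half-lines, which
  meet only in a null set.\<close>

lemma cdf_std_normal_zero: "cdf std_normal_distribution 0 = 1 / 2"
proof -
  interpret real_distribution std_normal_distribution
    by (rule real_dist_normal_dist)
  have "emeasure std_normal_distribution {..0}
      = (\<integral>\<^sup>+x. ennreal (std_normal_density x) * indicator {..0} x \<partial>lborel)"
    by (simp add: emeasure_density)
  also have "\<dots> = (\<integral>\<^sup>+x. ennreal (std_normal_density x) * indicator {0..} x \<partial>lborel)"
    by (subst nn_integral_real_affine[where c="-1" and t=0])
      (auto intro!: nn_integral_cong simp: normal_density_def indicator_def)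
  also have "\<dots> = emeasure std_normal_distribution {0..}"
    by (simp add: emeasure_density)
  finally have "emeasure std_normal_distribution {..0} = emeasure std_normal_distribution {0..}" .
  then have "prob {..0} = prob {0..}" by (simp add: emeasure_eq_measure)
  moreover have "prob {0} = 0"
    using isCont_cdf_std_normal[of 0] by (simp add: isCont_cdf)
  moreover have "prob {..0} + prob {0<..} = prob ({..0} \<union> {0<..})"
    by (rule finite_measure_Union[symmetric]) auto
  moreover have "{..0} \<union> {0<..} = (UNIV :: real set)" by auto
  moreover have "prob {0} + prob {0<..} = prob ({0} \<union> {0<..})"
    by (rule finite_measure_Union[symmetric]) auto
  moreover have "{0} \<union> {0<..} = {0 :: real ..}" by auto
  ultimately show ?thesis using prob_space by (simp add: cdf_def)
qed

text \<open>The definite description needs existence, from the intermediate value theorem between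
  the limits 0 and 1, and uniqueness, from strict monotonicity.\<close>

lemma upper_normal_quantile_works:
  assumes "0 < \<beta>" "\<beta> < 1"
  shows "1 - cdf std_normal_distribution (upper_normal_quantile \<beta>) = \<beta>"
proof -
  let ?F = "cdf std_normal_distribution"
  interpret real_distribution std_normal_distribution
    by (rule real_dist_normal_dist)
  from order_tendstoD(2)[OF cdf_lim_at_bot, of "1 - \<beta>"] assms
  obtain l where l: "\<And>x. x \<le> l \<Longrightarrow> ?F x < 1 - \<beta>"
    by (auto simp: eventually_at_bot_linorder)
  from order_tendstoD(1)[OF cdf_lim_at_top_prob, of "1 - \<beta>"] assms
  obtain h where h: "\<And>x. x \<ge> h \<Longrightarrow> ?F x > 1 - \<beta>"
    by (auto simp: eventually_at_top_linorder)
  \<comment> \<open>Taking \<open>min l h\<close> instead of \<open>l\<close> keeps the left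
    endpoint at or below \<open>h\<close>, as the intermediate value theorem requires.\<close>
  have "\<exists>x\<ge>min l h. x \<le> h \<and> ?F x = 1 - \<beta>"
    using l[of "min l h"] h[of h] isCont_cdf_std_normal by (intro IVT) auto
  then obtain x where x: "?F x = 1 - \<beta>" by blast
  show ?thesis unfolding upper_normal_quantile_def
  proof (rule theI)
    show "1 - ?F x = \<beta>" using x by simp
    show "z = x" if "1 - ?F z = \<beta>" for z
      using that x strict_mono_eq[OF cdf_std_normal_strict_mono] by auto
  qed
qed

text \<open>The median is 0. Positivity later permits division by the quantile, which turns an
  additive error into a relative one.\<close>

lemma upper_normal_quantile_pos:
  assumes "0 < \<beta>" "\<beta> < 1 / 2"
  shows "upper_normal_quantile \<beta> > 0"
  using upper_normal_quantile_works[of \<beta>] assms cdf_std_normal_zero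
    strict_mono_less[OF cdf_std_normal_strict_mono, of 0 "upper_normal_quantile \<beta>"] by simp

subsection \<open>Sumsets of sets of positive measure\<close>

text \<open>Difference-set form of Steinhaus' theorem. Choose an open \<open>U\<close> around
  \<open>K\<close> with \<open>U - K\<close> of smaller measure than \<open>K\<close>. A translate
  of \<open>K\<close> by less than the distance to the complement of \<open>U\<close> stays in
  \<open>U\<close>; if it missed \<open>K\<close>, it would have to fit into \<open>U - K\<close>,
  which is too small.\<close>

lemma compact_meets_translates:
  fixes K :: "real set"
  assumes "compact K" "measure lebesgue K > 0"
  obtains d where "d > 0" "\<And>y. \<bar>y\<bar> < d \<Longrightarrow> \<exists>u\<in>K. u + y \<in> K"
proof -
  have K: "K \<in> lmeasurable" using \<open>compact K\<close> by (rule lmeasurable_compact)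
  obtain U where U: "open U" "K \<subseteq> U" "U - K \<in> lmeasurable"
    "emeasure lebesgue (U - K) < ennreal (measure lebesgue K)"
    using sets_lebesgue_outer_open[of K "measure lebesgue K"] K assms by (auto simp: fmeasurable_def)
  have small: "measure lebesgue (U - K) < measure lebesgue K"
    using U(3,4) by (simp add: emeasure_eq_measure2 ennreal_less_iff)
  have "K \<inter> - U = {}" using U(2) by auto
  then obtain d where d: "d > 0" "\<And>x y. x \<in> K \<Longrightarrow> y \<in> - U \<Longrightarrow> d \<le> dist x y"
    using separate_compact_closed[OF \<open>compact K\<close> closed_Compl[OF U(1)]] by metis
  show thesis
  proof (rule that[OF d(1)])
    fix y :: real assume y: "\<bar>y\<bar> < d"
    show "\<exists>u\<in>K. u + y \<in> K"
    proof (rule ccontr)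
      assume no: "\<not> ?thesis"
      have "(+) y ` K \<subseteq> U - K"
        using no d(2) y by (fastforce simp: dist_real_def add.commute)
      moreover have "(+) y ` K \<in> lmeasurable" using K by (rule measurable_translation)
      ultimately have "measure lebesgue ((+) y ` K) \<le> measure lebesgue (U - K)"
        using U(3) by (intro measure_mono_fmeasurable) auto
      with small show False by (simp add: measure_translation)
    qed
  qed
qed

text \<open>By Fubini and translation invariance, the measure of the intersection of
  \<open>K\<close> with \<open>x - K\<close> integrates over \<open>x\<close> to the square of the
  measure of \<open>K\<close>, so it cannot vanish for every \<open>x\<close>.\<close>

lemma compact_meets_reflection:
  fixes K :: "real set"
  assumes "compact K" "measure lebesgue K > 0"
  obtains x where "measure lebesgue (K \<inter> (\<lambda>z. x - z) ` K) > 0"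
proof (rule ccontr)
  assume "\<not> thesis"
  then have null: "measure lebesgue (K \<inter> (\<lambda>z. x - z) ` K) = 0" for x
    using that by (metis measure_nonneg order_le_less)
  have [measurable]: "K \<in> sets borel" using assms by (simp add: borel_compact)
  have comp: "compact (K \<inter> (\<lambda>z. x - z) ` K)" for x
    using assms by (intro compact_Int compact_continuous_image continuous_intros)
  have "(\<integral>\<^sup>+y. indicator K y * indicator K (x - y) \<partial>lborel) = 0" for x
  proof -
    have "(\<integral>\<^sup>+y. indicator K y * indicator K (x - y) \<partial>lborel)
        = (\<integral>\<^sup>+y. indicator (K \<inter> (\<lambda>z. x - z) ` K) y \<partial>lborel)"
      by (intro nn_integral_cong) (auto simp: indicator_def image_iff)
    also have "\<dots> = emeasure lebesgue (K \<inter> (\<lambda>z. x - z) ` K)"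
      using comp[of x] by (simp add: borel_compact)
    also have "\<dots> = 0"
      using null[of x] emeasure_eq_measure2[OF lmeasurable_compact[OF comp]] by simp
    finally show ?thesis .
  qed
  then have "0 = (\<integral>\<^sup>+x. \<integral>\<^sup>+y. indicator K y * indicator K (x - y) \<partial>lborel \<partial>lborel)"
    by simp
  also have "\<dots> = (\<integral>\<^sup>+y. \<integral>\<^sup>+x. indicator K y * indicator K (x - y) \<partial>lborel \<partial>lborel)"
    by (rule lborel_pair.Fubini') measurable
  also have "\<dots> = (\<integral>\<^sup>+y. indicator K y * emeasure lborel K \<partial>lborel)"
  proof (intro nn_integral_cong)
    fix y :: real
    have "(\<integral>\<^sup>+x. indicator K (x - y) \<partial>lborel) = (\<integral>\<^sup>+x. indicator K x \<partial>lborel)"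
      by (subst nn_integral_real_affine[where c=1 and t=y]) auto
    then show "(\<integral>\<^sup>+x. indicator K y * indicator K (x - y) \<partial>lborel) = indicator K y * emeasure lborel K"
      by (simp add: nn_integral_cmult)
  qed
  also have "\<dots> = emeasure lborel K * emeasure lborel K"
    by (simp add: nn_integral_multc)
  finally have "emeasure lborel K = 0" by simp
  then show False
    using assms by (simp add: measure_def)
qed

text \<open>
  A set \<open>L\<close> symmetric about \<open>x / 2\<close> satisfies \<open>L + L = x + (L - L)\<close>, so the difference-set form
  of Steinhaus' theorem gives the sum-set form.
\<close>

lemma compact_sumset_interval:
  fixes K :: "real set"
  assumes "compact K" "measure lebesgue K > 0"
  obtains x d where "d > 0" "\<And>y. \<bar>y\<bar> < d \<Longrightarrow> \<exists>u\<in>K. \<exists>v\<in>K. x + y = u + v"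
proof -
  obtain x where x: "measure lebesgue (K \<inter> (\<lambda>z. x - z) ` K) > 0"
    using compact_meets_reflection[OF assms] .
  let ?L = "K \<inter> (\<lambda>z. x - z) ` K"
  have "compact ?L"
    using assms by (intro compact_Int compact_continuous_image continuous_intros)
  then obtain d where d: "d > 0" "\<And>y. \<bar>y\<bar> < d \<Longrightarrow> \<exists>u\<in>?L. u + y \<in> ?L"
    using compact_meets_translates[OF _ x] by metis
  show thesis
  proof (rule that[OF d(1)])
    fix y :: real assume "\<bar>y\<bar> < d"
    then obtain u where u: "u \<in> ?L" "u + y \<in> ?L" using d(2) by blast
    from u(1) obtain v where v: "v \<in> K" "u = x - v" by blast
    show "\<exists>u\<in>K. \<exists>v\<in>K. x + y = u + v"
      using u(2) v by (intro bexI[of _ "u + y"] bexI[of _ v]) auto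
  qed
qed

primrec iterated_sumset :: "nat \<Rightarrow> real set \<Rightarrow> real set" where
  "iterated_sumset 0 A = {0}"
| "iterated_sumset (Suc n) A = {x + y |x y. x \<in> A \<and> y \<in> iterated_sumset n A}"

lemma iterated_sumset_SucI:
  "x \<in> A \<Longrightarrow> y \<in> iterated_sumset n A \<Longrightarrow> x + y \<in> iterated_sumset (Suc n) A"
  by auto

text \<open>
  The interval contained in \<open>K + K\<close> is first stretched, by taking multiples, until it is longer
  than \<open>d - c\<close>; adding copies of \<open>c\<close> and \<open>d\<close> then leaves no gaps.
\<close>

lemma iterated_sumset_covers:
  assumes K: "compact K" "K \<subseteq> A" "measure lebesgue K > 0"
    and c: "c \<in> A" and d: "d \<in> A" and "c < d"
  obtains k x where "\<And>n. {real n * c + x..real n * d + x} \<subseteq> iterated_sumset (n + k) A"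
proof -
  obtain x e where e: "e > 0" "\<And>y. \<bar>y\<bar> < e \<Longrightarrow> \<exists>u\<in>K. \<exists>v\<in>K. x + y = u + v"
    using compact_sumset_interval[OF K(1,3)] by blast
  \<comment> \<open>Adding a decomposition of \<open>x + y\<close> to itself \<open>k\<close> times
    gives a \<open>2 * k\<close>-fold sum, so the radius of the covered interval grows from
    \<open>e\<close> to \<open>k * e\<close>.\<close>
  have mult: "real k * (x + y) \<in> iterated_sumset (2 * k) A" if y: "\<bar>y\<bar> < e" for k y
  proof (induction k)
    case (Suc k)
    obtain u v where uv: "u \<in> A" "v \<in> A" "x + y = u + v"
      using e(2)[OF y] K(2) by blast
    have "real (Suc k) * (x + y) = u + (v + real k * (x + y))"
      using uv(3) by (simp add: algebra_simps)
    moreover have "v + real k * (x + y) \<in> iterated_sumset (Suc (2 * k)) A"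
      using uv(2) Suc.IH by auto
    ultimately show ?case using uv(1) by auto
  qed simp
  obtain k :: nat where k: "(d - c) / e < real k"
    using reals_Archimedean2 by blast
  define h where "h = real k * e"
  have h: "d - c < h" using k e(1) by (simp add: h_def field_simps)
  have k0: "real k > 0"
    using k \<open>c < d\<close> e(1) by (meson diff_gt_0_iff_gt divide_pos_pos less_trans)
  have cover: "u \<in> iterated_sumset (n + 2 * k) A"
    if "real n * c + real k * x - h < u" "u < real n * d + real k * x + h" for n u
    using that
  proof (induction n arbitrary: u)
    case 0
    define y where "y = (u - real k * x) / real k"
    have "\<bar>real k * y\<bar> < real k * e" using 0 k0 by (simp add: y_def h_def)
    then have "\<bar>y\<bar> < e" using k0 by (simp add: abs_mult)
    from mult[OF this, of k] k0 show ?case by (simp add: y_def field_simps)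
  next
    case (Suc n)
    have nn: "real n * c \<le> real n * d" using \<open>c < d\<close> by (intro mult_left_mono) auto
    show ?case
    \<comment> \<open>Remove a copy of \<open>c\<close> as long as the remainder stays below the
      upper end, otherwise a copy of \<open>d\<close>; in the second case \<open>d - c < h\<close>
      keeps the remainder above the lower end.\<close>
    proof (cases "u - c < real n * d + real k * x + h")
      case True
      then have "u - c \<in> iterated_sumset (n + 2 * k) A"
        using Suc.prems by (intro Suc.IH) (auto simp: algebra_simps)
      from iterated_sumset_SucI[OF c this] show ?thesis by simp
    next
      case False
      then have "u - d \<in> iterated_sumset (n + 2 * k) A"
        using Suc.prems h nn \<open>c < d\<close> by (intro Suc.IH) (auto simp: algebra_simps)
      from iterated_sumset_SucI[OF d this] show ?thesis by simp
    qed
  qed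
  have "h > 0" using h \<open>c < d\<close> by simp
  then show thesis
    by (intro that[of "real k * x" "2 * k"] subsetI cover) auto
qed

subsection \<open>Paths of renewal processes\<close>

lemma strict_mono_partial_sums:
  fixes x :: "nat \<Rightarrow> real"
  assumes "\<And>i. 0 < x i"
  shows "strict_mono (\<lambda>n. \<Sum>i<n. x i)"
  using assms by (intro strict_monoI_Suc) simp

text \<open>The usual inversion between a counting process and its arrival times. The assumption
  \<open>ex\<close> makes the set under \<open>Max\<close> finite.\<close>

lemma renewal_count_ge_iff:
  assumes pos: "\<And>i. 0 < T i \<omega>" and "0 \<le> s" and ex: "\<exists>m. s < (\<Sum>i<m. T i \<omega>)"
  shows "n \<le> renewal_count T s \<omega> \<longleftrightarrow> (\<Sum>i<n. T i \<omega>) \<le> s"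
proof -
  let ?R = "\<lambda>n. \<Sum>i<n. T i \<omega>"
  note mono = strict_mono_partial_sums[of "\<lambda>i. T i \<omega>", OF pos]
  have le: "?R m \<le> ?R n \<longleftrightarrow> m \<le> n" for m n
    using strict_mono_less_eq[OF mono] by simp
  obtain m where m: "s < ?R m" using ex by blast
  have bound: "n < m" if "?R n \<le> s" for n
    using that m le[of m n] by (meson le_less_trans not_le)
  show ?thesis
  proof (cases "T 0 \<omega> > s")
    case True
    then have "?R 1 > s" by simp
    then have "\<not> ?R n \<le> s" if "n \<noteq> 0"
      using that le[of 1 n] by simp
    then show ?thesis
      using True \<open>0 \<le> s\<close> by (cases "n = 0") (auto simp: renewal_count_def)
  next
    case False
    let ?A = "{n. 1 \<le> n \<and> ?R n \<le> s}"
    have fin: "finite ?A"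
      using bound by (intro finite_subset[of ?A "{..<m}"]) auto
    have "1 \<in> ?A" using False by simp
    then have A: "?A \<noteq> {}" by blast
    have N: "renewal_count T s \<omega> = Max ?A"
      using False by (simp add: renewal_count_def)
    have "Max ?A \<in> ?A" using Max_in[OF fin A] .
    show ?thesis
    proof
      assume "n \<le> renewal_count T s \<omega>"
      then have "?R n \<le> ?R (Max ?A)" using N le by simp
      with \<open>Max ?A \<in> ?A\<close> show "?R n \<le> s" by simp
    next
      assume "?R n \<le> s"
      then show "n \<le> renewal_count T s \<omega>"
        using N Max_ge[OF fin, of n] by (cases "n = 0") auto
    qed
  qed
qed

lemma renewal_count_eq_iff:
  assumes "\<And>i. 0 < T i \<omega>" "0 \<le> s" "\<exists>m. s < (\<Sum>i<m. T i \<omega>)"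
  shows "renewal_count T s \<omega> = n \<longleftrightarrow> (\<Sum>i<n. T i \<omega>) \<le> s \<and> s < (\<Sum>i<Suc n. T i \<omega>)"
proof -
  have "renewal_count T s \<omega> = n \<longleftrightarrow> n \<le> renewal_count T s \<omega> \<and> \<not> Suc n \<le> renewal_count T s \<omega>"
    by auto
  then show ?thesis
    unfolding renewal_count_ge_iff[of T \<omega>, OF assms] by (simp only: not_le)
qed

text \<open>\<open>Max\<close> of an infinite set unfolds to \<open>the None\<close>. What matters
  is that this value depends neither on \<open>s\<close> nor on the outcome, so right-constancy and
  measurability survive on the explosion event.\<close>

lemma renewal_count_explosion:
  assumes pos: "\<And>i. 0 < T i \<omega>" and bdd: "\<And>m. (\<Sum>i<m. T i \<omega>) \<le> s"
  shows "renewal_count T s \<omega> = the None"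
proof -
  have "\<not> T 0 \<omega> > s" using bdd[of 1] by simp
  moreover have "{n. 1 \<le> n \<and> (\<Sum>i<n. T i \<omega>) \<le> s} = {1..}" using bdd by auto
  ultimately show ?thesis
    unfolding renewal_count_def by (simp add: Max.infinite infinite_Ici)
qed

text \<open>The count changes only at arrival times, so it is constant until the next arrival; after
  an explosion it is constant for good.\<close>

lemma renewal_count_right_constant:
  assumes pos: "\<And>i. 0 < T i \<omega>" and "0 \<le> s"
  obtains d where "d > 0"
    "\<And>s'. s \<le> s' \<Longrightarrow> s' < s + d \<Longrightarrow> renewal_count T s' \<omega> = renewal_count T s \<omega>"
proof (cases "\<exists>m. s < (\<Sum>i<m. T i \<omega>)")
  case True
  let ?N = "renewal_count T s \<omega>"
  let ?d = "(\<Sum>i<Suc ?N. T i \<omega>) - s"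
  have N: "(\<Sum>i<?N. T i \<omega>) \<le> s \<and> s < (\<Sum>i<Suc ?N. T i \<omega>)"
    using renewal_count_eq_iff[of T \<omega>, OF pos \<open>0 \<le> s\<close> True] by blast
  show thesis
  proof (rule that[of ?d])
    show "?d > 0" using N by simp
    fix s' assume s': "s \<le> s'" "s' < s + ?d"
    then have "\<exists>m. s' < (\<Sum>i<m. T i \<omega>)" by (intro exI[of _ "Suc ?N"]) simp
    then show "renewal_count T s' \<omega> = ?N"
      using s' N \<open>0 \<le> s\<close> by (subst renewal_count_eq_iff[of T \<omega>, OF pos]) auto
  qed
next
  case False
  then have bdd: "(\<Sum>i<m. T i \<omega>) \<le> s" for m by (simp add: not_less)
  show thesis
  proof (rule that[of 1])
    show "(1::real) > 0" by simp
    fix s' assume "s \<le> s'"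
    then have "(\<Sum>i<m. T i \<omega>) \<le> s'" for m using bdd[of m] by simp
    then show "renewal_count T s' \<omega> = renewal_count T s \<omega>"
      using bdd renewal_count_explosion[of T \<omega>, OF pos] by simp
  qed
qed

text \<open>
  Right-constancy of the paths makes the infimum in the ruin time harmless also on the event
  that infinitely many renewals occur in bounded time.
\<close>

lemma ruin_time_le_iff:
  assumes pos: "\<And>i. 0 < T i \<omega>" and "0 < t"
  shows "ruin_time T Y u 0 \<omega> \<le> ereal t \<longleftrightarrow> (\<exists>s. 0 < s \<and> s \<le> t \<and> u < compound_renewal T Y s \<omega>)"
proof
  assume "\<exists>s. 0 < s \<and> s \<le> t \<and> u < compound_renewal T Y s \<omega>"
  then obtain s where s: "0 < s" "s \<le> t" "u < compound_renewal T Y s \<omega>" by blast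
  then have "ruin_time T Y u 0 \<omega> \<le> ereal s"
    unfolding ruin_time_def by (intro Inf_lower) auto
  with s show "ruin_time T Y u 0 \<omega> \<le> ereal t"
    by (meson ereal_less_eq(3) order_trans)
next
  assume le: "ruin_time T Y u 0 \<omega> \<le> ereal t"
  show "\<exists>s. 0 < s \<and> s \<le> t \<and> u < compound_renewal T Y s \<omega>"
  proof (rule ccontr)
    assume no: "\<not> ?thesis"
    obtain d where d: "d > 0"
      "\<And>s'. t \<le> s' \<Longrightarrow> s' < t + d \<Longrightarrow> renewal_count T s' \<omega> = renewal_count T t \<omega>"
      using renewal_count_right_constant[of T \<omega> t] pos \<open>0 < t\<close> by (metis less_imp_le)
    \<comment> \<open>The path on \<open>[t, t + d)\<close> keeps its value at \<open>t\<close>, so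
      the level is first exceeded no earlier than \<open>t + d\<close>, which bounds the infimum
      away from \<open>t\<close>.\<close>
    have "t + d \<le> s" if "0 < s" "u < compound_renewal T Y s \<omega>" for s
    proof (rule ccontr)
      assume "\<not> t + d \<le> s"
      moreover have "t < s" using no that by (meson not_le)
      ultimately have "compound_renewal T Y s \<omega> = compound_renewal T Y t \<omega>"
        using d(2)[of s] by (simp add: compound_renewal_def)
      with no that \<open>0 < t\<close> show False by auto
    qed
    then have "ereal (t + d) \<le> ruin_time T Y u 0 \<omega>"
      unfolding ruin_time_def by (intro Inf_greatest) auto
    from this le have "ereal (t + d) \<le> ereal t" by (rule order_trans)
    with d show False by simp
  qed
qed

text \<open>Reduces the ruin event to a countable union, for measurability. The endpoint
  \<open>t\<close> is listed separately because rationals to its right are out of range.\<close>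

lemma exists_le_iff_exists_rat:
  fixes f :: "real \<Rightarrow> real"
  assumes "0 < t"
    and right: "\<And>s. 0 < s \<Longrightarrow> \<exists>d>0. \<forall>s'. s \<le> s' \<and> s' < s + d \<longrightarrow> f s' = f s"
  shows "(\<exists>s. 0 < s \<and> s \<le> t \<and> u < f s) \<longleftrightarrow>
    u < f t \<or> (\<exists>q::rat. 0 < real_of_rat q \<and> real_of_rat q \<le> t \<and> u < f (real_of_rat q))"
proof
  assume "\<exists>s. 0 < s \<and> s \<le> t \<and> u < f s"
  then obtain s where s: "0 < s" "s \<le> t" "u < f s" by blast
  show "u < f t \<or> (\<exists>q::rat. 0 < real_of_rat q \<and> real_of_rat q \<le> t \<and> u < f (real_of_rat q))"
  proof (cases "s = t")
    case False
    obtain d where d: "d > 0" "\<And>s'. s \<le> s' \<Longrightarrow> s' < s + d \<Longrightarrow> f s' = f s"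
      using right[OF s(1)] by blast
    obtain q where "s < real_of_rat q" "real_of_rat q < min t (s + d)"
      using of_rat_dense[of s "min t (s + d)"] False s d(1) by auto
    moreover from this s(1) have "0 < real_of_rat q" by linarith
    ultimately show ?thesis
      using d(2)[of "real_of_rat q"] s by (intro disjI2 exI[of _ q]) (simp del: zero_less_of_rat_iff)
  qed (use s in simp)
qed (use \<open>0 < t\<close> in blast)

subsection \<open>The grid of mesh of order \<open>sqrt t\<close>\<close>

text \<open>A discrete intermediate value theorem, used to find the pair of neighbouring indices
  that encloses the renewal count.\<close>

lemma nat_exists_switch:
  assumes "Q (0::nat)" "\<not> Q m"
  shows "\<exists>k<m. Q k \<and> \<not> Q (Suc k)"
proof (rule ccontr)
  assume no: "\<not> ?thesis"
  have "k \<le> m \<Longrightarrow> Q k" for k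
    using no assms(1) by (induction k) auto
  with assms(2) show False by simp
qed

text \<open>With \<open>a\<close> the mean waiting time, \<open>t / a\<close> is the typical number
  of renewals by time \<open>t\<close>, and \<open>x\<close> measures displacement on the scale of
  its fluctuations.\<close>

definition grid :: "real \<Rightarrow> real \<Rightarrow> real \<Rightarrow> nat" where
  "grid a x t = nat \<lfloor>t / a + x * sqrt t\<rfloor>"

lemma eventually_grid_bounds:
  assumes "0 < a"
  shows "\<forall>\<^sub>F t in at_top. t / a + x * sqrt t - 1 \<le> real (grid a x t) \<and>
    real (grid a x t) \<le> t / a + x * sqrt t"
  \<comment> \<open>From this threshold on, \<open>t / a + x * sqrt t\<close> is nonnegative, so
    \<open>nat\<close> does not truncate.\<close>
  using eventually_ge_at_top[of "(x * a)\<^sup>2"] eventually_ge_at_top[of 0]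
proof eventually_elim
  case (elim t)
  have "\<bar>x * a\<bar> \<le> sqrt t" using elim real_le_rsqrt[of "\<bar>x * a\<bar>" t] by simp
  then have "- (x * a) \<le> sqrt t" by linarith
  then have "0 \<le> sqrt t * (sqrt t / a + x)"
    using \<open>0 < a\<close> elim by (intro mult_nonneg_nonneg) (auto simp: field_simps)
  also have "\<dots> = t / a + x * sqrt t"
    using elim by (simp add: algebra_simps)
  finally show ?case
    using of_nat_floor[of "t / a + x * sqrt t"] floor_correct[of "t / a + x * sqrt t"]
    by (simp add: grid_def)
qed

lemma eventually_sqrt_bound:
  fixes A B C :: real
  assumes "0 < A"
  shows "\<forall>\<^sub>F t in at_top. B * sqrt t + C \<le> A * t"
proof -
  have "\<forall>\<^sub>F t in at_top. (\<bar>B\<bar> + \<bar>C\<bar>) / A \<le> sqrt t"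
    using filterlim_at_top[THEN iffD1, OF sqrt_at_top] by blast
  then show ?thesis
    using eventually_ge_at_top[of 1]
  proof eventually_elim
    case (elim t)
    have "1 \<le> sqrt t" using elim by simp
    have "B * sqrt t \<le> \<bar>B\<bar> * sqrt t" using elim by (intro mult_right_mono) auto
    moreover have "C \<le> \<bar>C\<bar> * sqrt t"
      using mult_left_mono[OF \<open>1 \<le> sqrt t\<close> abs_ge_zero[of C]] by linarith
    moreover have "(\<bar>B\<bar> + \<bar>C\<bar>) * sqrt t \<le> (A * sqrt t) * sqrt t"
      using elim \<open>0 < A\<close> by (intro mult_right_mono) (auto simp: field_simps)
    moreover have "(A * sqrt t) * sqrt t = A * t" using elim by (simp add: mult.assoc)
    ultimately show ?case unfolding distrib_right by linarith
  qed
qed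

lemma grid_quotient_tendsto:
  assumes "0 < a"
  shows "((\<lambda>t. real (grid a 0 t) / t) \<longlongrightarrow> 1 / a) at_top"
proof (rule tendsto_sandwich)
  have "((\<lambda>t::real. 1 / a - 1 / t) \<longlongrightarrow> 1 / a - 0) at_top"
    by (intro tendsto_diff tendsto_const tendsto_divide_0[OF tendsto_const] filterlim_at_top_imp_at_infinity filterlim_ident)
  then show "((\<lambda>t. 1 / a - 1 / t) \<longlongrightarrow> 1 / a) at_top" by simp
  show "\<forall>\<^sub>F t in at_top. 1 / a - 1 / t \<le> real (grid a 0 t) / t"
    using eventually_grid_bounds[OF assms, of 0] eventually_gt_at_top[of 0]
  proof eventually_elim
    case (elim t)
    then have "(t / a - 1) / t \<le> real (grid a 0 t) / t" by (intro divide_right_mono) auto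
    then show ?case using elim by (simp add: diff_divide_distrib)
  qed
  show "\<forall>\<^sub>F t in at_top. real (grid a 0 t) / t \<le> 1 / a"
    using eventually_grid_bounds[OF assms, of 0] eventually_gt_at_top[of 0]
  proof eventually_elim
    case (elim t)
    then have "real (grid a 0 t) / t \<le> (t / a) / t" by (intro divide_right_mono) auto
    then show ?case using elim by simp
  qed
qed (rule tendsto_const)

lemma filterlim_grid:
  assumes "0 < a"
  shows "filterlim (grid a 0) sequentially at_top"
  unfolding filterlim_at_top
proof
  fix n :: nat
  show "\<forall>\<^sub>F t in at_top. n \<le> grid a 0 t"
    using eventually_grid_bounds[OF assms, of 0] eventually_ge_at_top[of "a * (real n + 1)"]
  proof eventually_elim
    case (elim t)
    then have "real n + 1 \<le> t / a" using assms by (simp add: field_simps)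
    with elim show ?case by simp
  qed
qed

subsection \<open>Partial sums of i.i.d. positive variables\<close>

context prob_space
begin

section \<open>Second moments of sums of independent variables\<close>

text \<open>When one variable is split off, the cross term is a product of independent centred
  variables and has expectation zero. Integrability must be carried through the same
  induction.\<close>

lemma integral_square_sum_indep:
  fixes X :: "'i \<Rightarrow> 'a \<Rightarrow> real"
  assumes "finite A" "indep_vars (\<lambda>_. borel) X A"
    and "\<And>i. i \<in> A \<Longrightarrow> integrable M (\<lambda>\<omega>. (X i \<omega>)\<^sup>2)"
    and "\<And>i. i \<in> A \<Longrightarrow> expectation (X i) = 0"
  shows "integrable M (\<lambda>\<omega>. (\<Sum>i\<in>A. X i \<omega>)\<^sup>2) \<and>
    expectation (\<lambda>\<omega>. (\<Sum>i\<in>A. X i \<omega>)\<^sup>2) = (\<Sum>i\<in>A. expectation (\<lambda>\<omega>. (X i \<omega>)\<^sup>2))"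
  using assms
proof (induction A rule: finite_induct)
  case (insert j A)
  let ?S = "\<lambda>\<omega>. \<Sum>i\<in>A. X i \<omega>"
  have rv: "random_variable borel (X i)" if "i \<in> insert j A" for i
    using insert.prems(1) that by (auto simp: indep_vars_def)
  then have int: "integrable M (X i)" if "i \<in> insert j A" for i
    using insert.prems(2) that by (blast intro: square_integrable_imp_integrable)
  have ind: "indep_var borel (X j) borel ?S"
    by (rule indep_vars_sum[OF insert.hyps insert.prems(1)])
  have IH: "integrable M (\<lambda>\<omega>. (?S \<omega>)\<^sup>2)"
    "expectation (\<lambda>\<omega>. (?S \<omega>)\<^sup>2) = (\<Sum>i\<in>A. expectation (\<lambda>\<omega>. (X i \<omega>)\<^sup>2))"
    using insert.IH insert.prems indep_vars_subset[OF insert.prems(1), of A] by auto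
  have S: "integrable M ?S" using int by auto
  have XS: "integrable M (\<lambda>\<omega>. X j \<omega> * ?S \<omega>)" "expectation (\<lambda>\<omega>. X j \<omega> * ?S \<omega>) = 0"
    using indep_var_integrable[OF ind int S] indep_var_lebesgue_integral[OF ind int S]
      insert.prems(3)[of j] by auto
  have eq: "(\<Sum>i\<in>insert j A. X i \<omega>)\<^sup>2 = (X j \<omega>)\<^sup>2 + (2 * (X j \<omega> * ?S \<omega>) + (?S \<omega>)\<^sup>2)" for \<omega>
    using insert.hyps by (simp add: power2_sum algebra_simps)
  show ?case
    unfolding eq using insert.prems(2)[of j] insert.hyps XS IH by simp
qed simp

lemma Chebyshev_sum_indep:
  fixes X :: "'i \<Rightarrow> 'a \<Rightarrow> real"
  assumes "finite A" and ind: "indep_vars (\<lambda>_. borel) X A"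
    and sq: "\<And>i. i \<in> A \<Longrightarrow> integrable M (\<lambda>\<omega>. (X i \<omega>)\<^sup>2)"
    and mean: "\<And>i. i \<in> A \<Longrightarrow> expectation (X i) = m"
    and var: "\<And>i. i \<in> A \<Longrightarrow> variance (X i) = v"
    and "0 < a"
  shows "\<P>(\<omega> in M. a \<le> \<bar>(\<Sum>i\<in>A. X i \<omega>) - real (card A) * m\<bar>) \<le> real (card A) * v / a\<^sup>2"
proof -
  let ?X = "\<lambda>i \<omega>. X i \<omega> - m"
  have rv [measurable]: "random_variable borel (X i)" if "i \<in> A" for i
    using ind that by (auto simp: indep_vars_def)
  have int: "integrable M (X i)" if "i \<in> A" for i
    using square_integrable_imp_integrable[OF rv sq] that by blast
  have ind': "indep_vars (\<lambda>_. borel) ?X A"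
    by (rule indep_vars_compose2[OF ind]) simp
  have sq': "integrable M (\<lambda>\<omega>. (?X i \<omega>)\<^sup>2)" if "i \<in> A" for i
    using sq[OF that] int[OF that] by (simp add: power2_diff)
  have mean': "expectation (?X i) = 0" if "i \<in> A" for i
    using int[OF that] mean[OF that] prob_space by simp
  have var': "expectation (\<lambda>\<omega>. (?X i \<omega>)\<^sup>2) = v" if "i \<in> A" for i
    using var[OF that] mean[OF that] by simp
  note sum = integral_square_sum_indep[OF \<open>finite A\<close> ind' sq' mean']
  have "expectation (\<lambda>\<omega>. \<Sum>i\<in>A. ?X i \<omega>) = 0"
    using mean' int by (subst Bochner_Integration.integral_sum) auto
  moreover have "\<P>(\<omega> in M. a \<le> \<bar>(\<Sum>i\<in>A. ?X i \<omega>) - expectation (\<lambda>\<omega>. \<Sum>i\<in>A. ?X i \<omega>)\<bar>)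
      \<le> variance (\<lambda>\<omega>. \<Sum>i\<in>A. ?X i \<omega>) / a\<^sup>2"
    using sum \<open>0 < a\<close> by (intro Chebyshev_inequality) auto
  moreover have "(\<Sum>i\<in>A. ?X i \<omega>) = (\<Sum>i\<in>A. X i \<omega>) - real (card A) * m" for \<omega>
    by (simp add: sum_subtractf)
  ultimately show ?thesis using sum var' by simp
qed

end

section \<open>Positive i.i.d. sequences with a density\<close>

text \<open>Instantiated once for the waiting times and once for the rewards. The common density
  \<open>f\<close> encodes identical distribution.\<close>

locale iid_positive = prob_space M for M :: "'a measure" +
  fixes X :: "nat \<Rightarrow> 'a \<Rightarrow> real" and f :: "real \<Rightarrow> ennreal"
  assumes indep: "indep_vars (\<lambda>_. borel) X UNIV"
    and pos: "\<And>i \<omega>. \<omega> \<in> space M \<Longrightarrow> 0 < X i \<omega>"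
    and dens: "\<And>i. distributed M lborel (X i) f"
    and sq: "integrable M (\<lambda>\<omega>. (X 0 \<omega>)\<^sup>2)"
begin

definition "mean = expectation (X 0)"
definition "var = variance (X 0)"
definition "psum n \<omega> = (\<Sum>i<n. X i \<omega>)"

lemma rv [measurable]: "random_variable borel (X i)"
  using distributed_measurable[OF dens[of i]] by simp

lemma psum_measurable [measurable]: "random_variable borel (psum n)"
  unfolding psum_def[abs_def] by measurable

lemma psum_Suc: "psum (Suc n) \<omega> = X n \<omega> + psum n \<omega>"
  by (simp add: psum_def)

lemma psum_strict_mono: "\<omega> \<in> space M \<Longrightarrow> strict_mono (\<lambda>n. psum n \<omega>)"
  unfolding psum_def by (rule strict_mono_partial_sums) (rule pos)

lemma psum_mono: "\<omega> \<in> space M \<Longrightarrow> m \<le> n \<Longrightarrow> psum m \<omega> \<le> psum n \<omega>"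
  using strict_mono_less_eq[OF psum_strict_mono] by blast

lemma distr_eq: "distr M borel (X i) = distr M borel (X j)"
proof -
  have "distr M borel (X i) = distr M lborel (X i)" for i
    by (intro distr_cong) auto
  then show ?thesis
    using distributed_distr_eq_density[OF dens] by simp
qed

lemma integrable_comp:
  fixes g :: "real \<Rightarrow> real"
  assumes [measurable]: "g \<in> borel_measurable borel"
  shows "integrable M (\<lambda>\<omega>. g (X i \<omega>)) \<longleftrightarrow> integrable M (\<lambda>\<omega>. g (X 0 \<omega>))"
  using distr_eq[of i 0] integrable_distr_eq[of "X i" M borel g] integrable_distr_eq[of "X 0" M borel g]
  by simp

lemma expectation_comp:
  fixes g :: "real \<Rightarrow> real"
  assumes [measurable]: "g \<in> borel_measurable borel"
  shows "expectation (\<lambda>\<omega>. g (X i \<omega>)) = expectation (\<lambda>\<omega>. g (X 0 \<omega>))"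
  using distr_eq[of i 0] integral_distr[of "X i" M borel g] integral_distr[of "X 0" M borel g]
  by simp

lemma prob_comp:
  assumes "A \<in> sets borel"
  shows "\<P>(\<omega> in M. X i \<omega> \<in> A) = \<P>(\<omega> in M. X 0 \<omega> \<in> A)"
proof -
  have "measure (distr M borel (X i)) A = measure (distr M borel (X 0)) A"
    by (simp add: distr_eq[of i 0])
  then show ?thesis
    using assms by (simp add: measure_distr vimage_def Int_def conj_commute)
qed

lemma square_integrable: "integrable M (\<lambda>\<omega>. (X i \<omega>)\<^sup>2)"
  using integrable_comp[of "\<lambda>x. x\<^sup>2" i] sq by simp

lemma integrable: "integrable M (X i)"
  using square_integrable_imp_integrable[OF rv square_integrable] .

lemma expectation_eq: "expectation (X i) = mean"
  using expectation_comp[of "\<lambda>x. x" i] by (simp add: mean_def)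

lemma variance_eq_var: "variance (X i) = var"
  using expectation_comp[of "\<lambda>x. (x - mean)\<^sup>2" i]
  by (simp add: var_def expectation_eq mean_def[symmetric])

lemma mean_pos: "0 < mean"
  unfolding mean_def using pos by (intro expectation_greater integrable) auto

lemma var_nonneg: "0 \<le> var"
  unfolding var_def by (rule variance_positive)

text \<open>Both orders of \<open>m\<close> and \<open>n\<close> are allowed because grid points lie
  on either side of the central index.\<close>

lemma Chebyshev_psum:
  assumes "0 < a"
  shows "\<P>(\<omega> in M. a \<le> \<bar>psum n \<omega> - psum m \<omega> - (real n - real m) * mean\<bar>)
    \<le> \<bar>real n - real m\<bar> * var / a\<^sup>2"
proof -
  have *: "\<P>(\<omega> in M. a \<le> \<bar>psum n \<omega> - psum m \<omega> - (real n - real m) * mean\<bar>)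
      \<le> (real n - real m) * var / a\<^sup>2" if "m \<le> n" for m n
  proof -
    have "psum n \<omega> - psum m \<omega> = (\<Sum>i\<in>{m..<n}. X i \<omega>)" for \<omega>
      using that by (simp add: psum_def sum_diff_nat_ivl lessThan_atLeast0)
    then show ?thesis
      using Chebyshev_sum_indep[of "{m..<n}" X mean var a] that indep_vars_subset[OF indep]
        square_integrable expectation_eq variance_eq_var assms by (simp add: of_nat_diff)
  qed
  show ?thesis
  proof (cases "m \<le> n")
    case False
    have "\<bar>psum n \<omega> - psum m \<omega> - (real n - real m) * mean\<bar>
        = \<bar>psum m \<omega> - psum n \<omega> - (real m - real n) * mean\<bar>" for \<omega>
      by (simp add: abs_if algebra_simps)
    then show ?thesis using *[of n m] False by simp
  qed (use *[of m n] in simp)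
qed

lemma indep_var_psum: "indep_var borel (X n) borel (psum n)"
  unfolding psum_def[abs_def] using indep_vars_subset[OF indep] by (intro indep_vars_sum) auto

text \<open>By convolution every nonempty partial sum has a density. The empty sum is excluded since
  it is the constant 0.\<close>

lemma psum_no_atom:
  assumes "n \<noteq> 0"
  shows "\<P>(\<omega> in M. psum n \<omega> = x) = 0"
proof -
  have "\<exists>g. distributed M lborel (psum (Suc k)) g" for k
  proof (induction k)
    case 0
    have "psum (Suc 0) = X 0" by (simp add: psum_def fun_eq_iff)
    then show ?case using dens[of 0] by auto
  next
    case (Suc k)
    then obtain g where "distributed M lborel (psum (Suc k)) g" by blast
    from distributed_convolution[OF indep_var_psum dens this] show ?case
      by (simp add: psum_Suc[abs_def, symmetric] fun_eq_iff)
        (metis (no_types, lifting) ext psum_Suc)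
  qed
  moreover obtain k where "n = Suc k" using assms by (cases n) auto
  ultimately obtain g where g: "distributed M lborel (psum n) g" by blast
  have "emeasure M (psum n -` {x} \<inter> space M) = (\<integral>\<^sup>+y. g y * indicator {x} y \<partial>lborel)"
    by (rule distributed_emeasure[OF g]) simp
  also have "\<dots> = 0"
    using distributed_borel_measurable[OF g] by (simp add: nn_integral_indicator_singleton)
  finally show ?thesis
    by (simp add: measure_def vimage_def Int_def conj_commute)
qed

section \<open>The topological support of the common law\<close>

definition "supp = {x. \<forall>e>0. 0 < \<P>(\<omega> in M. \<bar>X 0 \<omega> - x\<bar> < e)}"

lemma closed_supp: "closed supp"
  unfolding closed_def open_dist
proof
  fix x assume "x \<in> - supp"
  then obtain e where e: "e > 0" "\<P>(\<omega> in M. \<bar>X 0 \<omega> - x\<bar> < e) = 0"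
    by (auto simp: supp_def not_less measure_le_0_iff)
  have "y \<in> - supp" if "dist y x < e / 2" for y
  proof -
    have "\<P>(\<omega> in M. \<bar>X 0 \<omega> - y\<bar> < e / 2) \<le> \<P>(\<omega> in M. \<bar>X 0 \<omega> - x\<bar> < e)"
      using that by (intro finite_measure_mono) (auto simp: dist_real_def abs_if split: if_splits)
    then show ?thesis
      using e by (auto simp: supp_def measure_le_0_iff intro!: exI[of _ "e / 2"])
  qed
  then show "\<exists>e>0. \<forall>y. dist y x < e \<longrightarrow> y \<in> - supp"
    using e(1) by (intro exI[of _ "e / 2"]) auto
qed

lemma supp_nonneg: "x \<in> supp \<Longrightarrow> 0 \<le> x"
proof (rule ccontr)
  assume x: "x \<in> supp" "\<not> 0 \<le> x"
  then have "0 < \<P>(\<omega> in M. \<bar>X 0 \<omega> - x\<bar> < - x)" by (auto simp: supp_def)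
  moreover have "{\<omega> \<in> space M. \<bar>X 0 \<omega> - x\<bar> < - x} = {}"
    using pos[of _ 0] by force
  ultimately show False by simp
qed

text \<open>A point outside the support lies in an interval with rational endpoints of probability
  zero, and there are only countably many of these.\<close>

lemma AE_supp: "AE \<omega> in M. X 0 \<omega> \<in> supp"
proof -
  have "AE \<omega> in M. \<P>(\<omega> in M. real_of_rat p < X 0 \<omega> \<and> X 0 \<omega> < real_of_rat q) = 0 \<longrightarrow>
      \<not> (real_of_rat p < X 0 \<omega> \<and> X 0 \<omega> < real_of_rat q)" (is "AE \<omega> in M. prob ?E = 0 \<longrightarrow> _") for p q
  proof (cases "prob ?E = 0")
    case True
    have "?E \<in> events" by measurable
    with True have "AE \<omega> in M. \<omega> \<notin> ?E" by (simp only: prob_eq_0)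
    with AE_space show ?thesis by eventually_elim auto
  qed simp
  then have "AE \<omega> in M. \<forall>p q. \<P>(\<omega> in M. real_of_rat p < X 0 \<omega> \<and> X 0 \<omega> < real_of_rat q) = 0 \<longrightarrow>
      \<not> (real_of_rat p < X 0 \<omega> \<and> X 0 \<omega> < real_of_rat q)"
    by (simp add: AE_all_countable)
  then show ?thesis
  proof eventually_elim
    case (elim \<omega>)
    show ?case
    proof (rule ccontr)
      assume "X 0 \<omega> \<notin> supp"
      then obtain e where e: "e > 0" "\<P>(\<omega>' in M. \<bar>X 0 \<omega>' - X 0 \<omega>\<bar> < e) = 0"
        by (auto simp: supp_def not_less measure_le_0_iff)
      obtain p q where pq: "X 0 \<omega> - e < real_of_rat p" "real_of_rat p < X 0 \<omega>"
        "X 0 \<omega> < real_of_rat q" "real_of_rat q < X 0 \<omega> + e"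
        using of_rat_dense[of "X 0 \<omega> - e" "X 0 \<omega>"] of_rat_dense[of "X 0 \<omega>" "X 0 \<omega> + e"] e(1) by auto
      have "\<P>(\<omega>' in M. real_of_rat p < X 0 \<omega>' \<and> X 0 \<omega>' < real_of_rat q)
          \<le> \<P>(\<omega>' in M. \<bar>X 0 \<omega>' - X 0 \<omega>\<bar> < e)"
        using pq by (intro finite_measure_mono) (auto simp: abs_if)
      with e(2) elim pq show False by (auto simp: measure_le_0_iff)
    qed
  qed
qed

text \<open>The support has probability one and the law has a density, so the support is not
  Lebesgue-null; hence one of its countably many bounded pieces has positive measure.\<close>

lemma supp_compact_part:
  obtains K where "compact K" "K \<subseteq> supp" "measure lebesgue K > 0"
proof (rule ccontr)
  assume no: "\<not> thesis"
  have [measurable]: "supp \<in> sets borel" using closed_supp by simp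
  define K where "K n = supp \<inter> {- real n..real n}" for n
  have K: "compact (K n)" for n
    unfolding K_def using closed_supp by (intro closed_Int_compact) auto
  have "measure lebesgue (K n) = 0" for n
    using no that[OF K] by (metis K_def inf_le1 measure_nonneg order_le_less)
  then have "emeasure lborel (K n) = 0" for n
    using emeasure_eq_measure2[OF lmeasurable_compact[OF K[of n]]] borel_compact[OF K[of n]] by simp
  then have "K n \<in> null_sets lborel" for n
    using borel_compact[OF K[of n]] by auto
  then have "(\<Union>n. K n) \<in> null_sets lborel" by (rule null_sets_UN)
  moreover have "(\<Union>n. K n) = supp"
  proof -
    have "\<exists>n. - real n \<le> x \<and> x \<le> real n" for x :: real
      using real_arch_simple[of "\<bar>x\<bar>"] by (auto simp: abs_le_iff) (metis minus_le_iff)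
    then show ?thesis by (auto simp: K_def)
  qed
  ultimately have null: "supp \<in> null_sets lborel" by simp
  have "emeasure M (X 0 -` supp \<inter> space M) = (\<integral>\<^sup>+y. f y * indicator supp y \<partial>lborel)"
    by (rule distributed_emeasure[OF dens]) simp
  also have "\<dots> = 0"
    using null by (rule nn_integral_null_set[of _ _ "f"])
  finally have "prob {\<omega> \<in> space M. X 0 \<omega> \<in> supp} = 0"
    by (simp add: measure_def vimage_def Int_def conj_commute)
  moreover have "prob {\<omega> \<in> space M. X 0 \<omega> \<in> supp} = 1"
    using AE_supp by (subst prob_eq_1) (auto elim: eventually_mono)
  ultimately show False by simp
qed

lemma not_AE_eq: "\<not> (AE \<omega> in M. X 0 \<omega> = x)"
proof
  assume "AE \<omega> in M. X 0 \<omega> = x"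
  then have "\<P>(\<omega> in M. psum 1 \<omega> = x) = 1"
    by (subst prob_eq_1) (auto simp: psum_def)
  then show False using psum_no_atom[of 1 x] by simp
qed

lemma var_pos: "0 < var"
proof -
  have "var \<noteq> 0"
  proof
    assume "var = 0"
    then have "expectation (\<lambda>\<omega>. (X 0 \<omega> - mean)\<^sup>2) = 0"
      by (simp add: var_def mean_def)
    moreover have "integrable M (\<lambda>\<omega>. (X 0 \<omega> - mean)\<^sup>2)"
      using sq integrable[of 0] by (simp add: power2_diff)
    ultimately have "AE \<omega> in M. (X 0 \<omega> - mean)\<^sup>2 = 0"
      by (subst (asm) integral_nonneg_eq_0_iff_AE) auto
    then show False using not_AE_eq[of mean] by simp
  qed
  with var_nonneg show ?thesis by simp
qed

text \<open>An increment over \<open>O(sqrt t)\<close> indices has variance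
  \<open>O(sqrt t)\<close>, while the squared threshold is of order \<open>t\<close>; Chebyshev's
  bound therefore decays like \<open>1 / sqrt t\<close>.\<close>

lemma tendsto_prob_psum_increment:
  fixes p q :: "real \<Rightarrow> nat"
  assumes "0 < e" and close: "\<forall>\<^sub>F t in at_top. \<bar>real (p t) - real (q t)\<bar> \<le> C * sqrt t"
  shows "((\<lambda>t. \<P>(\<omega> in M. e * sqrt t \<le>
    \<bar>psum (p t) \<omega> - psum (q t) \<omega> - (real (p t) - real (q t)) * mean\<bar>)) \<longlongrightarrow> 0) at_top"
proof (rule tendsto_sandwich[OF _ _ tendsto_const])
  show "\<forall>\<^sub>F t in at_top. \<P>(\<omega> in M. e * sqrt t \<le>
    \<bar>psum (p t) \<omega> - psum (q t) \<omega> - (real (p t) - real (q t)) * mean\<bar>) \<le> (C * var / e\<^sup>2) / sqrt t"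
    using close eventually_gt_at_top[of 0]
  proof eventually_elim
    case (elim t)
    have "\<P>(\<omega> in M. e * sqrt t \<le>
        \<bar>psum (p t) \<omega> - psum (q t) \<omega> - (real (p t) - real (q t)) * mean\<bar>)
        \<le> \<bar>real (p t) - real (q t)\<bar> * var / (e * sqrt t)\<^sup>2"
      using elim \<open>0 < e\<close> by (intro Chebyshev_psum) simp
    also have "\<dots> \<le> C * sqrt t * var / (e * sqrt t)\<^sup>2"
      using elim var_nonneg by (intro divide_right_mono mult_right_mono) auto
    also have "\<dots> = (C * var / e\<^sup>2) / sqrt t"
      using elim by (simp add: power2_eq_square)
    finally show ?case .
  qed
  show "((\<lambda>t. (C * var / e\<^sup>2) / sqrt t) \<longlongrightarrow> 0) at_top"
    by (rule real_tendsto_divide_at_top[OF tendsto_const sqrt_at_top])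
qed (auto intro: always_eventually)

text \<open>Were the support on one side of the mean, \<open>X 0 - mean\<close> would have constant
  sign and expectation zero, hence vanish almost surely, contradicting the density.\<close>

lemma supp_around_mean:
  obtains c d where "c \<in> supp" "d \<in> supp" "0 \<le> c" "c < mean" "mean < d"
proof -
  have zero: "expectation (\<lambda>\<omega>. X 0 \<omega> - mean) = 0" "expectation (\<lambda>\<omega>. mean - X 0 \<omega>) = 0"
    using integrable[of 0] prob_space by (auto simp: mean_def)
  have "\<exists>c\<in>supp. c < mean"
  proof (rule ccontr)
    assume "\<not> ?thesis"
    then have ae: "AE \<omega> in M. 0 \<le> X 0 \<omega> - mean"
      using AE_supp by (auto elim!: eventually_mono simp: not_less)
    then have "AE \<omega> in M. X 0 \<omega> - mean = 0"
      using zero integrable[of 0] by (subst integral_nonneg_eq_0_iff_AE[symmetric]) auto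
    then show False using not_AE_eq[of mean] by simp
  qed
  moreover have "\<exists>d\<in>supp. mean < d"
  proof (rule ccontr)
    assume "\<not> ?thesis"
    then have ae: "AE \<omega> in M. 0 \<le> mean - X 0 \<omega>"
      using AE_supp by (auto elim!: eventually_mono simp: not_less)
    then have "AE \<omega> in M. mean - X 0 \<omega> = 0"
      using zero integrable[of 0] by (subst integral_nonneg_eq_0_iff_AE[symmetric]) auto
    then have "AE \<omega> in M. X 0 \<omega> = mean" by eventually_elim simp
    then show False using not_AE_eq[of mean] by simp
  qed
  ultimately show thesis using that supp_nonneg by blast
qed

text \<open>Split the target point into a point of the support and a shorter sum; by independence
  both are approximated to within \<open>e / 2\<close> simultaneously with positive
  probability.\<close>

lemma psum_near_iterated_sumset:
  assumes "x \<in> iterated_sumset n supp" "e > 0"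
  shows "0 < \<P>(\<omega> in M. \<bar>psum n \<omega> - x\<bar> < e)"
  using assms
proof (induction n arbitrary: x e)
  case 0
  then show ?case by (simp add: psum_def prob_space)
next
  case (Suc n)
  then obtain y z where yz: "x = y + z" "y \<in> supp" "z \<in> iterated_sumset n supp" by auto
  let ?A = "{w. \<bar>w - y\<bar> < e / 2}" and ?B = "{w. \<bar>w - z\<bar> < e / 2}"
  have "0 < \<P>(\<omega> in M. X 0 \<omega> \<in> ?A)"
    using yz(2) \<open>e > 0\<close> unfolding supp_def by (simp del: less_divide_eq_numeral1)
  then have "0 < \<P>(\<omega> in M. X n \<omega> \<in> ?A)"
    by (subst prob_comp) auto
  moreover have "0 < \<P>(\<omega> in M. psum n \<omega> \<in> ?B)"
    using Suc.IH[OF yz(3), of "e / 2"] \<open>e > 0\<close> by simp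
  ultimately have "0 < \<P>(\<omega> in M. X n \<omega> \<in> ?A \<and> psum n \<omega> \<in> ?B)"
    by (subst prob_indep_random_variable[OF indep_var_psum]) auto
  also have "\<dots> \<le> \<P>(\<omega> in M. \<bar>psum (Suc n) \<omega> - x\<bar> < e)"
    by (intro finite_measure_mono) (auto simp: psum_Suc yz(1) abs_if split: if_splits)
  finally show ?case .
qed

text \<open>Here \<open>k\<close> is a fixed number of summands spent on creating an interval. Since
  \<open>c < mean < d\<close>, the covered interval extends linearly in \<open>n\<close> to both
  sides of \<open>n * mean\<close>.\<close>

lemma psum_covers:
  obtains c d x k where "0 \<le> c" "c < mean" "mean < d"
    "\<And>n u e. real n * c + x \<le> u \<Longrightarrow> u \<le> real n * d + x \<Longrightarrow> 0 < e \<Longrightarrow>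
      0 < \<P>(\<omega> in M. \<bar>psum (n + k) \<omega> - u\<bar> < e)"
proof -
  obtain c d where cd: "c \<in> supp" "d \<in> supp" "0 \<le> c" "c < mean" "mean < d"
    using supp_around_mean .
  obtain K where K: "compact K" "K \<subseteq> supp" "measure lebesgue K > 0"
    using supp_compact_part .
  obtain k x where "\<And>n. {real n * c + x..real n * d + x} \<subseteq> iterated_sumset (n + k) supp"
    using iterated_sumset_covers[OF K cd(1,2)] cd(4,5) by (metis less_trans)
  then show thesis
    using cd by (intro that[of c d x k] psum_near_iterated_sumset) (auto simp: subset_iff)
qed

section \<open>Bracketing the number of renewals\<close>

text \<open>Tightness of the renewal count on the scale \<open>sqrt t\<close>: at the two grid
  points the expected partial sums lie on opposite sides of \<open>t\<close> at a distance of order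
  \<open>sqrt t\<close>, and Chebyshev's inequality keeps the sums there.\<close>

lemma eventually_prob_grid_brackets:
  assumes "0 < e"
  obtains x where "0 < x" "\<forall>\<^sub>F t in at_top.
    \<P>(\<omega> in M. t < psum (grid mean (- x) t) \<omega> \<or> psum (grid mean x t) \<omega> \<le> t) \<le> e"
proof -
  \<comment> \<open>makes the Chebyshev bounds at the two grid points add up to \<open>e\<close>\<close>
  define x where "x = sqrt (16 * var / (mean ^ 3 * e))"
  have x: "0 < x" and x2: "x\<^sup>2 = 16 * var / (mean ^ 3 * e)"
    using var_pos mean_pos \<open>0 < e\<close> by (auto simp: x_def)
  have "\<forall>\<^sub>F t in at_top. 2 / x \<le> sqrt t" "\<forall>\<^sub>F t in at_top. x * mean \<le> sqrt t"
    using filterlim_at_top[THEN iffD1, OF sqrt_at_top] by blast+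
  then have "\<forall>\<^sub>F t in at_top.
    \<P>(\<omega> in M. t < psum (grid mean (- x) t) \<omega> \<or> psum (grid mean x t) \<omega> \<le> t) \<le> e"
    using eventually_grid_bounds[OF mean_pos, of x] eventually_grid_bounds[OF mean_pos, of "- x"]
      eventually_gt_at_top[of 0]
  proof eventually_elim
    case (elim t)
    \<comment> \<open>\<open>?h\<close> is half the nominal distance of the expected sums from
      \<open>t\<close>; the other half absorbs the rounding in \<open>grid\<close>, since
      \<open>x * sqrt t\<close> is at least 2. The second threshold on \<open>sqrt t\<close> bounds
      the number of summands by \<open>2 * t / mean\<close>.\<close>
    let ?p = "grid mean (- x) t" and ?q = "grid mean x t" and ?h = "x * sqrt t * mean / 2"
    have h: "0 < ?h" using x elim mean_pos by simp
    have xt: "2 \<le> x * sqrt t" using elim x by (simp add: field_simps)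
    then have h1: "?h \<le> (x * sqrt t - 1) * mean"
      using mean_pos by (simp add: field_simps)
    have "x * mean * sqrt t \<le> sqrt t * sqrt t"
      using elim by (intro mult_right_mono) auto
    then have le: "x * sqrt t \<le> t / mean"
      using elim mean_pos by (simp add: field_simps)
    have dev: "\<P>(\<omega> in M. ?h \<le> \<bar>psum n \<omega> - real n * mean\<bar>) \<le> e / 2"
      if "real n \<le> t / mean + x * sqrt t" for n
    proof -
      have "\<P>(\<omega> in M. ?h \<le> \<bar>psum n \<omega> - real n * mean\<bar>) \<le> real n * var / ?h\<^sup>2"
        using Chebyshev_psum[OF h, of n 0] by (simp add: psum_def)
      also have "\<dots> \<le> (2 * t / mean) * var / ?h\<^sup>2"
        using that le var_nonneg by (intro divide_right_mono mult_right_mono) auto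
      also have "?h\<^sup>2 = x\<^sup>2 * t * mean\<^sup>2 / 4"
        using elim by (simp add: power_mult_distrib power_divide)
      also have "(2 * t / mean) * var / (x\<^sup>2 * t * mean\<^sup>2 / 4) = e / 2"
        unfolding x2 using elim mean_pos var_pos \<open>0 < e\<close>
        by (simp add: field_simps power2_eq_square power3_eq_cube)
      finally show ?thesis .
    qed
    have "\<P>(\<omega> in M. t < psum ?p \<omega> \<or> psum ?q \<omega> \<le> t)
        \<le> prob ({\<omega> \<in> space M. ?h \<le> \<bar>psum ?p \<omega> - real ?p * mean\<bar>} \<union>
                {\<omega> \<in> space M. ?h \<le> \<bar>psum ?q \<omega> - real ?q * mean\<bar>})"
    proof (intro finite_measure_mono subsetI)
      fix \<omega> assume \<omega>: "\<omega> \<in> {\<omega> \<in> space M. t < psum ?p \<omega> \<or> psum ?q \<omega> \<le> t}"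
      have "real ?p * mean \<le> (t / mean - x * sqrt t) * mean"
        using elim mean_pos by (intro mult_right_mono) auto
      also have "\<dots> = t - 2 * ?h" using mean_pos by (simp add: left_diff_distrib)
      finally have p: "real ?p * mean \<le> t - 2 * ?h" .
      have "(t / mean + x * sqrt t - 1) * mean \<le> real ?q * mean"
        using elim mean_pos by (intro mult_right_mono) auto
      then have q: "t + ?h \<le> real ?q * mean" using h1 mean_pos by (simp add: algebra_simps)
      show "\<omega> \<in> {\<omega> \<in> space M. ?h \<le> \<bar>psum ?p \<omega> - real ?p * mean\<bar>} \<union>
                {\<omega> \<in> space M. ?h \<le> \<bar>psum ?q \<omega> - real ?q * mean\<bar>}"
        using \<omega> p q h by (auto simp: abs_if)
    qed measurable
    also have "\<dots> \<le> e / 2 + e / 2"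
      using elim xt by (intro order_trans[OF measure_Un_le] add_mono dev) auto
    finally show ?case by simp
  qed
  with x show thesis by (rule that)
qed

text \<open>If no partial sum exceeds \<open>t\<close>, the upper bracket fails at every time
  \<open>s \<ge> t\<close>, an event of probability at most \<open>e\<close> for large
  \<open>s\<close>. So explosion is a null event.\<close>

lemma AE_psum_unbounded: "AE \<omega> in M. \<exists>m. t < psum m \<omega>"
proof -
  let ?E = "{\<omega> \<in> space M. \<forall>m. psum m \<omega> \<le> t}"
  have "prob ?E \<le> 0 + e" if e: "0 < e" for e
  proof -
    obtain x where "0 < x" "\<forall>\<^sub>F t in at_top.
        \<P>(\<omega> in M. t < psum (grid mean (- x) t) \<omega> \<or> psum (grid mean x t) \<omega> \<le> t) \<le> e"
      using eventually_prob_grid_brackets[OF e] .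
    then obtain s where s: "t \<le> s"
        "\<P>(\<omega> in M. s < psum (grid mean (- x) s) \<omega> \<or> psum (grid mean x s) \<omega> \<le> s) \<le> e"
      unfolding eventually_at_top_linorder by (meson max.cobounded1 max.cobounded2)
    have "prob ?E \<le> \<P>(\<omega> in M. s < psum (grid mean (- x) s) \<omega> \<or> psum (grid mean x s) \<omega> \<le> s)"
      using s(1) by (intro finite_measure_mono) (auto intro: order_trans[rotated])
    with s(2) show ?thesis by simp
  qed
  then have "prob ?E \<le> 0" by (rule field_le_epsilon)
  then have "prob ?E = 0" by (simp add: measure_le_0_iff)
  moreover have "?E \<in> events" by measurable
  ultimately have "AE \<omega> in M. \<omega> \<notin> ?E" by (simp only: prob_eq_0)
  with AE_space show ?thesis by eventually_elim (auto simp: not_le)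
qed

end

subsection \<open>The compound renewal process\<close>

text \<open>Indexing by \<open>nat + nat\<close> through \<open>case_sum\<close> expresses
  independence within and between the two sequences in one hypothesis.\<close>

locale renewal_reward = prob_space P for P :: "'a measure" +
  fixes T Y :: "nat \<Rightarrow> 'a \<Rightarrow> real" and f\<^sub>T f\<^sub>Y :: "real \<Rightarrow> ennreal"
  assumes indep_TY: "indep_vars (\<lambda>_. borel) (case_sum T Y) UNIV"
    and T_pos: "\<And>i \<omega>. \<omega> \<in> space P \<Longrightarrow> 0 < T i \<omega>"
    and Y_pos: "\<And>i \<omega>. \<omega> \<in> space P \<Longrightarrow> 0 < Y i \<omega>"
    and T_dens: "\<And>i. distributed P lborel (T i) f\<^sub>T"
    and Y_dens: "\<And>i. distributed P lborel (Y i) f\<^sub>Y"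
    and T_sq: "integrable P (\<lambda>\<omega>. (T 0 \<omega>)\<^sup>2)"
    and Y_sq: "integrable P (\<lambda>\<omega>. (Y 0 \<omega>)\<^sup>2)"
begin

text \<open>Functions of disjoint blocks are independent; suitable blocks yield the independence of
  \<open>T\<close>, of \<open>Y\<close> and of \<open>Z\<close>.\<close>

lemma indep_vars_block:
  assumes "\<And>j. g j \<in> borel_measurable (PiM (K j) (\<lambda>_. borel))"
    and "disjoint_family K"
  shows "indep_vars (\<lambda>_. borel) (\<lambda>j \<omega>. g j (restrict (\<lambda>i. case_sum T Y i \<omega>) (K j))) (UNIV :: nat set)"
  by (rule indep_vars_compose2[OF indep_vars_restrict[OF indep_TY]]) (use assms in auto)

lemma indep_T: "indep_vars (\<lambda>_. borel) T UNIV"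
  using indep_vars_block[of "\<lambda>j x. x (Inl j)" "\<lambda>j. {Inl j}"] by (simp add: disjoint_family_on_def)

lemma indep_Y: "indep_vars (\<lambda>_. borel) Y UNIV"
  using indep_vars_block[of "\<lambda>j x. x (Inr j)" "\<lambda>j. {Inr j}"] by (simp add: disjoint_family_on_def)

sublocale T: iid_positive P T f\<^sub>T
  by unfold_locales (use indep_T T_pos T_dens T_sq in auto)

sublocale Y: iid_positive P Y f\<^sub>Y
  by unfold_locales (use indep_Y Y_pos Y_dens Y_sq in auto)

section \<open>The centred sequence and its central limit theorem\<close>

definition "ratio = Y.mean / T.mean"
definition "Z n \<omega> = Y n \<omega> - ratio * T n \<omega>"
definition "Zvar = Y.var + ratio\<^sup>2 * T.var"

lemma ratio_pos: "0 < ratio"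
  using T.mean_pos Y.mean_pos by (simp add: ratio_def)

lemma Zvar_pos: "0 < Zvar"
  using Y.var_pos T.var_nonneg by (simp add: Zvar_def add_pos_nonneg)

lemma indep_Z: "indep_vars (\<lambda>_. borel) Z UNIV"
  using indep_vars_block[of "\<lambda>j x. x (Inr j) - ratio * x (Inl j)" "\<lambda>j. {Inl j, Inr j}"]
  by (simp add: disjoint_family_on_def Z_def[abs_def])

lemma indep_var_TY: "indep_var borel (T n) borel (Y n)"
proof -
  have "indep_var borel ((\<lambda>x. x (Inl n)) \<circ> (\<lambda>\<omega>. restrict (\<lambda>i. case_sum T Y i \<omega>) {Inl n}))
    borel ((\<lambda>x. x (Inr n)) \<circ> (\<lambda>\<omega>. restrict (\<lambda>i. case_sum T Y i \<omega>) {Inr n}))"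
    by (rule indep_var_compose[OF indep_var_restrict[OF indep_TY]]) auto
  then show ?thesis by (simp add: comp_def)
qed

lemma distr_Z: "distr P borel (Z n) = distr P borel (Z 0)"
proof -
  have "distr P borel (Z n)
      = distr (distr P borel (T n) \<Otimes>\<^sub>M distr P borel (Y n)) borel (\<lambda>(x, y). y - ratio * x)" for n
  proof -
    have "distr P borel (T n) \<Otimes>\<^sub>M distr P borel (Y n)
        = distr P (borel \<Otimes>\<^sub>M borel) (\<lambda>\<omega>. (T n \<omega>, Y n \<omega>))"
      using indep_var_TY[of n] by (simp add: indep_var_distribution_eq)
    then show ?thesis
      by (simp add: distr_distr comp_def Z_def[abs_def])
  qed
  then show ?thesis
    by (simp add: T.distr_eq[of n 0] Y.distr_eq[of n 0])
qed

text \<open>The factor \<open>ratio\<close> is chosen so that the means cancel, and independence of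
  \<open>T n\<close> and \<open>Y n\<close> removes the covariance from the second moment.\<close>

lemma Z_moments:
  shows "expectation (Z n) = 0" "integrable P (\<lambda>\<omega>. (Z n \<omega>)\<^sup>2)"
    "expectation (\<lambda>\<omega>. (Z n \<omega>)\<^sup>2) = Zvar"
proof -
  let ?Y = "\<lambda>\<omega>. Y n \<omega> - Y.mean" and ?T = "\<lambda>\<omega>. T n \<omega> - T.mean"
  have Z_eq: "Z n \<omega> = ?Y \<omega> - ratio * ?T \<omega>" for \<omega>
    using T.mean_pos by (simp add: Z_def ratio_def field_simps)
  have int: "integrable P ?Y" "integrable P ?T" "integrable P (\<lambda>\<omega>. (?Y \<omega>)\<^sup>2)" "integrable P (\<lambda>\<omega>. (?T \<omega>)\<^sup>2)"
    using T.integrable Y.integrable T.square_integrable Y.square_integrable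
    by (auto simp: power2_diff)
  have zero: "expectation ?Y = 0" "expectation ?T = 0"
    using T.integrable Y.integrable T.expectation_eq Y.expectation_eq prob_space by auto
  have "indep_var borel ((\<lambda>x. x - T.mean) \<circ> T n) borel ((\<lambda>x. x - Y.mean) \<circ> Y n)"
    by (rule indep_var_compose[OF indep_var_TY]) auto
  then have ind: "indep_var borel ?T borel ?Y" by (simp add: comp_def)
  have cross: "integrable P (\<lambda>\<omega>. ?T \<omega> * ?Y \<omega>)" "expectation (\<lambda>\<omega>. ?T \<omega> * ?Y \<omega>) = 0"
    using indep_var_integrable[OF ind int(2,1)] indep_var_lebesgue_integral[OF ind int(2,1)] zero by auto
  have sq_eq: "(Z n \<omega>)\<^sup>2 = (?Y \<omega>)\<^sup>2 + ratio\<^sup>2 * (?T \<omega>)\<^sup>2 - 2 * ratio * (?T \<omega> * ?Y \<omega>)" for \<omega>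
    unfolding Z_eq by (simp add: power2_eq_square algebra_simps)
  show "expectation (Z n) = 0"
    unfolding Z_eq[abs_def] using int zero by simp
  show "integrable P (\<lambda>\<omega>. (Z n \<omega>)\<^sup>2)"
    unfolding sq_eq using int cross by simp
  show "expectation (\<lambda>\<omega>. (Z n \<omega>)\<^sup>2) = Zvar"
    unfolding sq_eq using int cross T.variance_eq_var[of n] Y.variance_eq_var[of n]
    by (simp add: Zvar_def T.expectation_eq Y.expectation_eq)
qed

definition "Zsum n \<omega> = Y.psum n \<omega> - ratio * T.psum n \<omega>"

lemma Zsum_measurable [measurable]: "random_variable borel (Zsum n)"
  unfolding Zsum_def[abs_def] by measurable

lemma Zsum_CLT:
  "(\<lambda>n. \<P>(\<omega> in P. z * sqrt (real n * Zvar) < Zsum n \<omega>))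
    \<longlonglongrightarrow> 1 - cdf std_normal_distribution z"
proof -
  have sum: "(\<Sum>i<n. Z i \<omega>) = Zsum n \<omega>" for n \<omega>
    by (simp add: Zsum_def Z_def Y.psum_def T.psum_def sum_subtractf sum_distrib_left)
  have "weak_conv_m (\<lambda>n. distr P borel (\<lambda>\<omega>. (\<Sum>i<n. Z i \<omega> - 0) / sqrt (real n * (sqrt Zvar)\<^sup>2)))
      std_normal_distribution"
    using Zvar_pos Z_moments by (intro central_limit_theorem[OF indep_Z _ _ _ _ distr_Z]) auto
  then have lim: "(\<lambda>n. cdf (distr P borel (\<lambda>\<omega>. Zsum n \<omega> / sqrt (real n * Zvar))) z)
      \<longlonglongrightarrow> cdf std_normal_distribution z"
    using isCont_cdf_std_normal Zvar_pos by (simp add: weak_conv_m_def weak_conv_def sum)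
  have "\<forall>\<^sub>F n in sequentially. 1 - cdf (distr P borel (\<lambda>\<omega>. Zsum n \<omega> / sqrt (real n * Zvar))) z
      = \<P>(\<omega> in P. z * sqrt (real n * Zvar) < Zsum n \<omega>)"
    \<comment> \<open>The case \<open>n = 0\<close> is left out because the normalising factor is
      then zero.\<close>
    using eventually_gt_at_top[of 0]
  proof eventually_elim
    case (elim n)
    have "cdf (distr P borel (\<lambda>\<omega>. Zsum n \<omega> / sqrt (real n * Zvar))) z
        = prob {\<omega> \<in> space P. Zsum n \<omega> \<le> z * sqrt (real n * Zvar)}"
      using elim Zvar_pos
      by (auto simp: cdf_def measure_distr field_simps intro!: arg_cong[where f=prob])
    then show ?case
      using prob_neg[of "\<lambda>\<omega>. Zsum n \<omega> \<le> z * sqrt (real n * Zvar)"] by (simp add: not_le)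
  qed
  with tendsto_diff[OF tendsto_const lim, of 1] show ?thesis
    by (rule Lim_transform_eventually)
qed

section \<open>Measurability of the compound process and the ruin probability\<close>

abbreviation "V \<equiv> compound_renewal T Y"

lemma V_eq: "V t \<omega> = Y.psum (renewal_count T t \<omega>) \<omega>"
  by (simp add: compound_renewal_def Y.psum_def)

lemma le_renewal_count_iff:
  "\<omega> \<in> space P \<Longrightarrow> 0 \<le> t \<Longrightarrow> t < T.psum m \<omega> \<Longrightarrow>
    n \<le> renewal_count T t \<omega> \<longleftrightarrow> T.psum n \<omega> \<le> t"
  using renewal_count_ge_iff[of T \<omega> t n] T_pos by (auto simp: T.psum_def)

lemma renewal_count_eqI:
  "\<omega> \<in> space P \<Longrightarrow> 0 \<le> t \<Longrightarrow> T.psum n \<omega> \<le> t \<Longrightarrow> t < T.psum (Suc n) \<omega> \<Longrightarrow>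
    renewal_count T t \<omega> = n"
  using le_renewal_count_iff[of \<omega> t "Suc n" n] le_renewal_count_iff[of \<omega> t "Suc n" "Suc n"] by simp

text \<open>The count is a least index over measurable events, or a constant on the explosion event;
  \<open>V t\<close> is then a partial sum at a measurable index with countably many values.\<close>

lemma V_measurable [measurable]:
  assumes "0 \<le> t"
  shows "random_variable borel (V t)"
proof -
  have eq: "renewal_count T t \<omega> =
      (if \<exists>m. t < T.psum m \<omega> then LEAST n. t < T.psum (Suc n) \<omega> else the None)"
    if "\<omega> \<in> space P" for \<omega>
  proof (cases "\<exists>m. t < T.psum m \<omega>")
    case True
    then obtain m where m: "t < T.psum m \<omega>" by blast
    let ?N = "renewal_count T t \<omega>"
    note iff = le_renewal_count_iff[OF that \<open>0 \<le> t\<close> m]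
    have "(LEAST n. t < T.psum (Suc n) \<omega>) = ?N"
    proof (rule Least_equality)
      show "t < T.psum (Suc ?N) \<omega>" using iff[of "Suc ?N"] by simp
      show "?N \<le> y" if "t < T.psum (Suc y) \<omega>" for y
        using iff[of "Suc y"] that by simp
    qed
    with True show ?thesis by simp
  next
    case False
    then have "renewal_count T t \<omega> = the None"
      by (intro renewal_count_explosion T_pos that) (auto simp: T.psum_def not_less)
    with False show ?thesis by simp
  qed
  have "renewal_count T t \<in> measurable P (count_space UNIV)"
    by (subst measurable_cong[OF eq]) measurable
  then show ?thesis
    unfolding V_eq[abs_def] by (rule measurable_compose_countable[rotated]) simp
qed

lemma V_mono:
  assumes "\<omega> \<in> space P" "0 \<le> s" "s \<le> t" "t < T.psum m \<omega>"
  shows "V s \<omega> \<le> V t \<omega>"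
proof -
  let ?n = "renewal_count T s \<omega>"
  have "T.psum ?n \<omega> \<le> s"
    using le_renewal_count_iff[of \<omega> s m ?n] assms by simp
  then have "?n \<le> renewal_count T t \<omega>"
    using le_renewal_count_iff[of \<omega> t m ?n] assms by simp
  then show ?thesis
    unfolding V_eq using assms(1) by (intro Y.psum_mono)
qed

text \<open>Outside the null explosion event the path is monotone up to \<open>t\<close>, so
  exceeding \<open>u\<close> at some time means exceeding it at \<open>t\<close>. Measurability of
  the ruin event comes first, through rational times.\<close>

lemma prob_ruin_time_le:
  assumes "0 < t"
  shows "\<P>(\<omega> in P. ruin_time T Y u 0 \<omega> \<le> ereal t) = \<P>(\<omega> in P. u < V t \<omega>)"
proof -
  have right: "\<exists>d>0. \<forall>s'. s \<le> s' \<and> s' < s + d \<longrightarrow> V s' \<omega> = V s \<omega>"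
    if "\<omega> \<in> space P" "0 < s" for \<omega> s
    using renewal_count_right_constant[of T \<omega> s] T_pos that
    by (metis compound_renewal_def less_imp_le)
  have iff: "ruin_time T Y u 0 \<omega> \<le> ereal t \<longleftrightarrow>
      u < V t \<omega> \<or> (\<exists>q::rat. 0 < real_of_rat q \<and> real_of_rat q \<le> t \<and> u < V (real_of_rat q) \<omega>)"
    if "\<omega> \<in> space P" for \<omega>
    using ruin_time_le_iff[of T \<omega> t Y u] T_pos[OF that] \<open>0 < t\<close>
      exists_le_iff_exists_rat[of t "\<lambda>s. V s \<omega>" u, OF \<open>0 < t\<close> right[OF that]] by simp
  have "{\<omega> \<in> space P. ruin_time T Y u 0 \<omega> \<le> ereal t} =
      {\<omega> \<in> space P. u < V t \<omega>} \<union>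
      (\<Union>q\<in>{q. 0 < real_of_rat q \<and> real_of_rat q \<le> t}. {\<omega> \<in> space P. u < V (real_of_rat q) \<omega>})"
    using iff by blast
  also have "\<dots> \<in> events"
  proof -
    have "{\<omega> \<in> space P. u < V s \<omega>} \<in> events" if "0 < s" for s
      using V_measurable[of s] that by simp
    then show ?thesis
      using \<open>0 < t\<close> by (intro sets.Un sets.countable_UN'') auto
  qed
  finally have meas: "{\<omega> \<in> space P. ruin_time T Y u 0 \<omega> \<le> ereal t} \<in> events" .
  have "AE \<omega> in P. ruin_time T Y u 0 \<omega> \<le> ereal t \<longleftrightarrow> u < V t \<omega>"
    using T.AE_psum_unbounded[of t] AE_space
  proof eventually_elim
    case (elim \<omega>)
    then obtain m where m: "t < T.psum m \<omega>" by blast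
    have "u < V t \<omega>" if "0 < s" "s \<le> t" "u < V s \<omega>" for s
      using V_mono[OF elim(2) _ that(2) m] that by simp
    with iff[OF elim(2)] show ?case by blast
  qed
  then show ?thesis
    using meas \<open>0 < t\<close> by (intro measure_eq_AE) (auto elim: eventually_mono)
qed

section \<open>Continuity of the law and existence of the level\<close>

text \<open>\<open>V t\<close> always equals some partial sum of rewards; of these countably many
  variables only the empty sum has an atom, and it sits at 0.\<close>

lemma AE_V_neq:
  assumes "0 < u"
  shows "AE \<omega> in P. V t \<omega> \<noteq> u"
proof -
  have "AE \<omega> in P. Y.psum n \<omega> \<noteq> u" for n
  proof (cases "n = 0")
    case True
    then show ?thesis using assms by (simp add: Y.psum_def)
  next
    case False
    have "{\<omega> \<in> space P. Y.psum n \<omega> = u} \<in> events" by measurable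
    with Y.psum_no_atom[OF False, of u] have "AE \<omega> in P. \<omega> \<notin> {\<omega> \<in> space P. Y.psum n \<omega> = u}"
      by (simp only: prob_eq_0)
    with AE_space show ?thesis by eventually_elim auto
  qed
  then have "AE \<omega> in P. \<forall>n. Y.psum n \<omega> \<noteq> u" by (simp add: AE_all_countable)
  then show ?thesis by eventually_elim (simp add: V_eq)
qed

lemma tail_antimono: "0 \<le> t \<Longrightarrow> u \<le> v \<Longrightarrow> \<P>(\<omega> in P. v < V t \<omega>) \<le> \<P>(\<omega> in P. u < V t \<omega>)"
  by (intro finite_measure_mono) auto

lemma tail_attains:
  assumes "0 \<le> t" and \<alpha>: "0 < \<alpha>" "\<alpha> \<le> \<P>(\<omega> in P. 0 < V t \<omega>)"
  shows "\<exists>u\<ge>0. \<P>(\<omega> in P. u < V t \<omega>) = \<alpha>"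
proof -
  note [measurable] = V_measurable[OF \<open>0 \<le> t\<close>]
  interpret D: real_distribution "distr P borel (V t)"
    by (rule real_distribution_distr) measurable
  let ?F = "cdf (distr P borel (V t))"
  have F: "?F u = 1 - \<P>(\<omega> in P. u < V t \<omega>)" for u
  proof -
    have "?F u = \<P>(\<omega> in P. V t \<omega> \<le> u)"
      by (auto simp: cdf_def measure_distr intro!: arg_cong[where f=prob])
    then show ?thesis
      using prob_neg[of "\<lambda>\<omega>. u < V t \<omega>"] by (simp add: not_less)
  qed
  have cont: "isCont ?F u" if "0 < u" for u
  proof -
    have "{\<omega> \<in> space P. V t \<omega> = u} \<in> events" by simp
    moreover have "AE \<omega> in P. \<omega> \<notin> {\<omega> \<in> space P. V t \<omega> = u}"
      using AE_V_neq[OF that, of t] by eventually_elim simp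
    ultimately have "\<P>(\<omega> in P. V t \<omega> = u) = 0" by (simp only: prob_eq_0)
    then show ?thesis
      by (simp add: D.isCont_cdf measure_distr vimage_def Int_def conj_commute)
  qed
  show ?thesis
  \<comment> \<open>The law of \<open>V t\<close> may have an atom at 0. If \<alpha> equals the tail
    there, \<open>u = 0\<close> is a solution; otherwise right-continuity moves the starting point
    to some \<open>l > 0\<close>, beyond which the distribution function is continuous.\<close>
  proof (cases "\<alpha> = \<P>(\<omega> in P. 0 < V t \<omega>)")
    case False
    then have F0: "?F 0 < 1 - \<alpha>" using \<alpha> by (simp add: F)
    have "\<forall>\<^sub>F u in at_right 0. ?F u < 1 - \<alpha>"
      using D.cdf_is_right_cont[of 0] F0 by (auto simp: continuous_within intro: order_tendstoD)
    then have "\<forall>\<^sub>F u in at_right 0. ?F u < 1 - \<alpha> \<and> 0 < u"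
      using eventually_at_right_less[of 0] by eventually_elim auto
    then obtain l where l: "0 < l" "?F l < 1 - \<alpha>"
      using eventually_happens[of _ "at_right (0::real)"] by auto
    from order_tendstoD(1)[OF D.cdf_lim_at_top_prob, of "1 - \<alpha>"] \<alpha>
    obtain h where h: "1 - \<alpha> < ?F h" "l \<le> h"
      unfolding eventually_at_top_linorder by (metis diff_less_eq less_add_same_cancel1 linear max.cobounded1 max.cobounded2)
    have "\<exists>x\<ge>l. x \<le> h \<and> ?F x = 1 - \<alpha>"
      using l h cont by (intro IVT) auto
    then obtain x where "l \<le> x" "?F x = 1 - \<alpha>" by blast
    then show ?thesis using l(1) F[of x] by (intro exI[of _ x]) auto
  qed auto
qed

section \<open>Approximation by a sum of deterministic length\<close>

text \<open>The deterministic core. The renewal count lies between \<open>p\<close> and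
  \<open>q\<close>, so \<open>V t\<close> lies between the reward sums at these indices. The bounds
  on \<open>T\<close> translate the index displacement from \<open>n\<close> into elapsed time, up
  to an error \<open>E\<close>, and the gap between \<open>p\<close> and \<open>q\<close> costs at
  most \<open>Y.mean * G\<close>.\<close>

lemma compound_renewal_sandwich:
  assumes \<omega>: "\<omega> \<in> space P" and "0 \<le> t"
    and p: "T.psum p \<omega> \<le> t" "t < T.psum q \<omega>"
    and Tp: "\<bar>T.psum p \<omega> - T.psum n \<omega> - (real p - real n) * T.mean\<bar> \<le> E"
    and Tq: "\<bar>T.psum q \<omega> - T.psum n \<omega> - (real q - real n) * T.mean\<bar> \<le> E"
    and Yp: "\<bar>Y.psum p \<omega> - Y.psum n \<omega> - (real p - real n) * Y.mean\<bar> \<le> E"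
    and Yq: "\<bar>Y.psum q \<omega> - Y.psum n \<omega> - (real q - real n) * Y.mean\<bar> \<le> E"
    and gap: "real q - real p \<le> G"
  shows "\<bar>V t \<omega> - (ratio * t + Zsum n \<omega>)\<bar> \<le> (1 + ratio) * E + Y.mean * G"
proof -
  let ?N = "renewal_count T t \<omega>"
  note iff = le_renewal_count_iff[OF \<omega> \<open>0 \<le> t\<close> p(2)]
  have "p \<le> ?N" "?N \<le> q" using iff[of p] iff[of q] p by auto
  then have V: "Y.psum p \<omega> \<le> V t \<omega>" "V t \<omega> \<le> Y.psum q \<omega>"
    unfolding V_eq using \<omega> by (auto intro: Y.psum_mono)
  have conv: "ratio * (x * T.mean) = x * Y.mean" for x
    using T.mean_pos by (simp add: ratio_def)
  have "(real p - real n) * T.mean \<le> t - T.psum n \<omega> + E"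
    using Tp p(1) by linarith
  from mult_left_mono[OF this less_imp_le[OF ratio_pos]]
  have up: "(real p - real n) * Y.mean \<le> ratio * (t - T.psum n \<omega> + E)" by (simp add: conv)
  have "t - T.psum n \<omega> - E \<le> (real q - real n) * T.mean"
    using Tq p(2) by linarith
  from mult_left_mono[OF this less_imp_le[OF ratio_pos]]
  have lo: "ratio * (t - T.psum n \<omega> - E) \<le> (real q - real n) * Y.mean" by (simp add: conv)
  have "(real q - real p) * Y.mean \<le> G * Y.mean"
    using gap Y.mean_pos by (intro mult_right_mono) auto
  then have gap': "(real q - real n) * Y.mean \<le> (real p - real n) * Y.mean + Y.mean * G"
    by (simp add: algebra_simps)
  show ?thesis
    using V Yp Yq up lo gap'
    unfolding Zsum_def abs_le_iff distrib_right[of 1] distrib_left right_diff_distrib by linarith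
qed

text \<open>
  The fluctuation of the number of renewals is controlled on a finite grid of mesh of order
  \<open>sqrt t\<close>; between neighbouring grid points monotonicity of both partial sums replaces a maximal
  inequality.
\<close>

lemma compound_renewal_approx:
  assumes "0 < \<eta>"
  shows "((\<lambda>t. \<P>(\<omega> in P. \<eta> * sqrt t < \<bar>V t \<omega> - (ratio * t + Zsum (grid T.mean 0 t) \<omega>)\<bar>))
    \<longlongrightarrow> 0) at_top" (is "(?f \<longlongrightarrow> 0) at_top")
proof (rule tendstoI)
  fix e :: real assume "0 < e"
  then have "0 < e / 2" by simp
  obtain x where x: "0 < x" "\<forall>\<^sub>F t in at_top. \<P>(\<omega> in P. t < T.psum (grid T.mean (- x) t) \<omega> \<or>
      T.psum (grid T.mean x t) \<omega> \<le> t) \<le> e / 2"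
    using T.eventually_prob_grid_brackets[OF \<open>0 < e / 2\<close>] .
  \<comment> \<open>Error budget: \<open>\<eta> / 4\<close> for the increments at the grid points,
    \<open>\<eta> / 8\<close> for the mesh and \<open>\<eta> / 8\<close> for rounding, all in units
    of \<open>sqrt t\<close>.\<close>
  define \<epsilon> where "\<epsilon> = \<eta> / (4 * (1 + ratio))"
  have \<epsilon>: "0 < \<epsilon>" "(1 + ratio) * \<epsilon> = \<eta> / 4"
    using ratio_pos \<open>0 < \<eta>\<close> by (auto simp: \<epsilon>_def field_simps)
  obtain m0 :: nat where m0: "16 * x * Y.mean / \<eta> < real m0"
    using reals_Archimedean2 by blast
  define m where "m = Suc m0"
  have m: "0 < real m" "16 * x * Y.mean / \<eta> \<le> real m" using m0 by (auto simp: m_def)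
  define \<delta> where "\<delta> = 2 * x / real m"
  have \<delta>: "0 < \<delta>" "Y.mean * \<delta> \<le> \<eta> / 8" "real m * \<delta> = 2 * x"
    using m x(1) \<open>0 < \<eta>\<close> by (auto simp: \<delta>_def field_simps)
  define q where "q k t = grid T.mean (- x + real k * \<delta>) t" for k t
  define n where "n = grid T.mean 0"
  have q0: "q 0 t = grid T.mean (- x) t" and qm: "q m t = grid T.mean x t" for t
    using \<delta>(3) by (simp_all add: q_def)
  have q_bounds: "\<forall>\<^sub>F t in at_top. t / T.mean + (- x + real k * \<delta>) * sqrt t - 1 \<le> real (q k t) \<and>
      real (q k t) \<le> t / T.mean + (- x + real k * \<delta>) * sqrt t" for k
    unfolding q_def by (rule eventually_grid_bounds[OF T.mean_pos])
  have n_bounds: "\<forall>\<^sub>F t in at_top. t / T.mean - 1 \<le> real (n t) \<and> real (n t) \<le> t / T.mean"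
    using eventually_grid_bounds[OF T.mean_pos, of 0] by (simp add: n_def)
  have close: "\<forall>\<^sub>F t in at_top. \<bar>real (q k t) - real (n t)\<bar> \<le> (\<bar>- x + real k * \<delta>\<bar> + 1) * sqrt t" for k
    using q_bounds[of k] n_bounds eventually_ge_at_top[of 1]
  proof eventually_elim
    case (elim t)
    have "\<bar>(- x + real k * \<delta>) * sqrt t\<bar> = \<bar>- x + real k * \<delta>\<bar> * sqrt t"
      using elim by (simp add: abs_mult)
    with abs_ge_self[of "(- x + real k * \<delta>) * sqrt t"]
      abs_ge_minus_self[of "(- x + real k * \<delta>) * sqrt t"]
    have "(- x + real k * \<delta>) * sqrt t \<le> \<bar>- x + real k * \<delta>\<bar> * sqrt t"
      "- ((- x + real k * \<delta>) * sqrt t) \<le> \<bar>- x + real k * \<delta>\<bar> * sqrt t" by simp_all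
    moreover have "1 \<le> sqrt t" using elim by simp
    ultimately show ?case using elim unfolding abs_le_iff distrib_right[of _ 1] by linarith
  qed
  define B where "B k t = {\<omega> \<in> space P. \<epsilon> * sqrt t \<le>
        \<bar>T.psum (q k t) \<omega> - T.psum (n t) \<omega> - (real (q k t) - real (n t)) * T.mean\<bar>} \<union>
      {\<omega> \<in> space P. \<epsilon> * sqrt t \<le>
        \<bar>Y.psum (q k t) \<omega> - Y.psum (n t) \<omega> - (real (q k t) - real (n t)) * Y.mean\<bar>}" for k t
  have B_meas [measurable]: "B k t \<in> events" for k t
    unfolding B_def by measurable
  have "((\<lambda>t. prob (B k t)) \<longlongrightarrow> 0) at_top" for k
  proof (rule tendsto_sandwich[OF _ _ tendsto_const])
    from tendsto_add[OF T.tendsto_prob_psum_increment[OF \<epsilon>(1) close] Y.tendsto_prob_psum_increment[OF \<epsilon>(1) close]]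
    show "((\<lambda>t. \<P>(\<omega> in P. \<epsilon> * sqrt t \<le>
        \<bar>T.psum (q k t) \<omega> - T.psum (n t) \<omega> - (real (q k t) - real (n t)) * T.mean\<bar>) +
      \<P>(\<omega> in P. \<epsilon> * sqrt t \<le>
        \<bar>Y.psum (q k t) \<omega> - Y.psum (n t) \<omega> - (real (q k t) - real (n t)) * Y.mean\<bar>)) \<longlongrightarrow> 0) at_top"
      by simp
    show "\<forall>\<^sub>F t in at_top. prob (B k t) \<le> \<P>(\<omega> in P. \<epsilon> * sqrt t \<le>
        \<bar>T.psum (q k t) \<omega> - T.psum (n t) \<omega> - (real (q k t) - real (n t)) * T.mean\<bar>) +
      \<P>(\<omega> in P. \<epsilon> * sqrt t \<le>
        \<bar>Y.psum (q k t) \<omega> - Y.psum (n t) \<omega> - (real (q k t) - real (n t)) * Y.mean\<bar>)"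
      unfolding B_def by (intro always_eventually allI measure_Un_le) measurable
  qed (auto intro: always_eventually)
  \<comment> \<open>The number of grid points depends on \<open>e\<close> and \<open>\<eta>\<close>
    but not on \<open>t\<close>, so the bad events can simply be summed.\<close>
  then have "((\<lambda>t. \<Sum>k\<le>m. prob (B k t)) \<longlongrightarrow> (\<Sum>k\<le>m. 0)) at_top"
    by (rule tendsto_sum)
  then have small: "\<forall>\<^sub>F t in at_top. (\<Sum>k\<le>m. prob (B k t)) < e / 2"
    using \<open>0 < e\<close> by (intro order_tendstoD(2)) auto
  have gaps: "\<forall>\<^sub>F t in at_top. \<forall>k\<in>{..<m}. real (q (Suc k) t) - real (q k t) \<le> \<delta> * sqrt t + 1"
  proof (intro eventually_ball_finite ballI)
    fix k
    show "\<forall>\<^sub>F t in at_top. real (q (Suc k) t) - real (q k t) \<le> \<delta> * sqrt t + 1"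
      using q_bounds[of k] q_bounds[of "Suc k"] by eventually_elim (simp add: algebra_simps)
  qed simp
  have "\<forall>\<^sub>F t in at_top. 8 * Y.mean / \<eta> \<le> sqrt t"
    using filterlim_at_top[THEN iffD1, OF sqrt_at_top] by blast
  then have "\<forall>\<^sub>F t in at_top. ?f t < e"
    using x(2) small gaps eventually_gt_at_top[of 0]
  proof eventually_elim
    case (elim t)
    let ?A = "{\<omega> \<in> space P. t < T.psum (q 0 t) \<omega> \<or> T.psum (q m t) \<omega> \<le> t}"
    have "Y.mean \<le> \<eta> * sqrt t / 8"
      using elim \<open>0 < \<eta>\<close> by (simp add: field_simps)
    moreover have "Y.mean * (\<delta> * sqrt t) \<le> \<eta> * sqrt t / 8"
      using mult_right_mono[OF \<delta>(2), of "sqrt t"] elim by (simp add: mult.assoc)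
    moreover have "(1 + ratio) * (\<epsilon> * sqrt t) = \<eta> * sqrt t / 4"
      by (simp add: \<epsilon>(2) flip: mult.assoc)
    moreover have "0 \<le> \<eta> * sqrt t" using elim \<open>0 < \<eta>\<close> by simp
    ultimately have total: "(1 + ratio) * (\<epsilon> * sqrt t) + Y.mean * (\<delta> * sqrt t + 1) \<le> \<eta> * sqrt t"
      unfolding distrib_left[of Y.mean] by linarith
    have "?f t \<le> prob (?A \<union> (\<Union>k\<le>m. B k t))"
    proof (intro finite_measure_mono subsetI)
      fix \<omega> assume "\<omega> \<in> {\<omega> \<in> space P. \<eta> * sqrt t < \<bar>V t \<omega> - (ratio * t + Zsum (grid T.mean 0 t) \<omega>)\<bar>}"
      then have \<omega>: "\<omega> \<in> space P" and large: "\<eta> * sqrt t < \<bar>V t \<omega> - (ratio * t + Zsum (n t) \<omega>)\<bar>"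
        by (auto simp: n_def)
      show "\<omega> \<in> ?A \<union> (\<Union>k\<le>m. B k t)"
      proof (rule ccontr)
        assume no: "\<not> ?thesis"
        then have "T.psum (q 0 t) \<omega> \<le> t" "\<not> T.psum (q m t) \<omega> \<le> t" using \<omega> by auto
        \<comment> \<open>This selects the grid cell containing the renewal count, which varies with
          the outcome; excluding all bad events beforehand makes that harmless.\<close>
        then obtain k where k: "k < m" "T.psum (q k t) \<omega> \<le> t" "\<not> T.psum (q (Suc k) t) \<omega> \<le> t"
          using nat_exists_switch[of "\<lambda>k. T.psum (q k t) \<omega> \<le> t" m] by blast
        have nB: "\<omega> \<notin> B k t" "\<omega> \<notin> B (Suc k) t" using no k(1) by auto
        have "\<bar>V t \<omega> - (ratio * t + Zsum (n t) \<omega>)\<bar>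
            \<le> (1 + ratio) * (\<epsilon> * sqrt t) + Y.mean * (\<delta> * sqrt t + 1)"
          using k nB \<omega> elim
          by (intro compound_renewal_sandwich[of \<omega> t "q k t" "q (Suc k) t"]) (auto simp: B_def)
        with total large show False by linarith
      qed
    qed measurable
    also have "\<dots> \<le> prob ?A + (\<Sum>k\<le>m. prob (B k t))"
      by (intro order_trans[OF measure_Un_le] add_mono finite_measure_subadditive_finite) auto
    also have "\<dots> < e"
      using elim by (simp add: q0 qm)
    finally show ?case .
  qed
  then show "\<forall>\<^sub>F t in at_top. dist (?f t) 0 < e" by eventually_elim simp
qed

section \<open>Normal limits for the tails\<close>

text \<open>The asymptotic standard deviation of \<open>V t\<close> on the scale
  \<open>sqrt t\<close>; it coincides with the coefficient \<open>D / M powr (3 / 2)\<close> of the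
  theorem.\<close>

definition "sdev = sqrt (Zvar / T.mean)"

lemma sdev_pos: "0 < sdev"
  using Zvar_pos T.mean_pos by (simp add: sdev_def)

lemma normal_threshold_tendsto:
  "((\<lambda>t. z * sqrt (real (grid T.mean 0 t) * Zvar) / sqrt t) \<longlongrightarrow> sdev * z) at_top"
proof -
  have "((\<lambda>t. z * sqrt (real (grid T.mean 0 t) / t * Zvar)) \<longlongrightarrow> z * sqrt (1 / T.mean * Zvar)) at_top"
    by (intro tendsto_intros grid_quotient_tendsto T.mean_pos)
  moreover have "z * sqrt (real (grid T.mean 0 t) / t * Zvar)
      = z * sqrt (real (grid T.mean 0 t) * Zvar) / sqrt t" for t
    by (simp add: real_sqrt_divide)
  ultimately show ?thesis by (simp add: sdev_def mult.commute)
qed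

lemma Zsum_grid_CLT:
  "((\<lambda>t. \<P>(\<omega> in P. z * sqrt (real (grid T.mean 0 t) * Zvar) < Zsum (grid T.mean 0 t) \<omega>))
    \<longlongrightarrow> 1 - cdf std_normal_distribution z) at_top"
  using filterlim_compose[OF Zsum_CLT filterlim_grid[OF T.mean_pos]] .

text \<open>Half of the gap between \<open>y\<close> and \<open>sdev * z\<close> pays for the
  approximation error, the other half for replacing the threshold of the central limit theorem by
  its limit.\<close>

lemma eventually_tail_gt:
  assumes "y < sdev * z" "\<beta> < 1 - cdf std_normal_distribution z"
  shows "\<forall>\<^sub>F t in at_top. \<beta> < \<P>(\<omega> in P. ratio * t + y * sqrt t < V t \<omega>)"
proof -
  define \<eta> where "\<eta> = (sdev * z - y) / 2"
  have \<eta>: "0 < \<eta>" "y + \<eta> < sdev * z" using assms(1) by (auto simp: \<eta>_def field_simps)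
  have lim: "\<forall>\<^sub>F t in at_top. \<beta> <
      \<P>(\<omega> in P. z * sqrt (real (grid T.mean 0 t) * Zvar) < Zsum (grid T.mean 0 t) \<omega>) -
      \<P>(\<omega> in P. \<eta> * sqrt t < \<bar>V t \<omega> - (ratio * t + Zsum (grid T.mean 0 t) \<omega>)\<bar>)"
    using tendsto_diff[OF Zsum_grid_CLT[of z] compound_renewal_approx[OF \<eta>(1)]] assms(2)
    by (intro order_tendstoD(1)) auto
  show ?thesis
    using lim order_tendstoD(1)[OF normal_threshold_tendsto \<eta>(2)] eventually_gt_at_top[of 0]
  proof eventually_elim
    case (elim t)
    note [measurable] = V_measurable[OF less_imp_le[OF elim(3)]]
    let ?n = "grid T.mean 0 t"
    let ?Bad = "{\<omega> \<in> space P. \<eta> * sqrt t < \<bar>V t \<omega> - (ratio * t + Zsum ?n \<omega>)\<bar>}"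
    have thr: "(y + \<eta>) * sqrt t < z * sqrt (real ?n * Zvar)"
      using elim by (simp add: pos_less_divide_eq)
    have "\<P>(\<omega> in P. z * sqrt (real ?n * Zvar) < Zsum ?n \<omega>)
        \<le> prob ({\<omega> \<in> space P. ratio * t + y * sqrt t < V t \<omega>} \<union> ?Bad)"
      by (intro finite_measure_mono, use thr in \<open>auto simp: abs_le_iff not_less distrib_right\<close>)
    also have "\<dots> \<le> \<P>(\<omega> in P. ratio * t + y * sqrt t < V t \<omega>) + prob ?Bad"
      by (rule measure_Un_le) measurable
    finally show ?case using elim by simp
  qed
qed

lemma eventually_tail_less:
  assumes "sdev * z < y" "1 - cdf std_normal_distribution z < \<beta>"
  shows "\<forall>\<^sub>F t in at_top. \<P>(\<omega> in P. ratio * t + y * sqrt t < V t \<omega>) < \<beta>"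
proof -
  define \<eta> where "\<eta> = (y - sdev * z) / 2"
  have \<eta>: "0 < \<eta>" "sdev * z < y - \<eta>" using assms(1) by (auto simp: \<eta>_def field_simps)
  have lim: "\<forall>\<^sub>F t in at_top.
      \<P>(\<omega> in P. z * sqrt (real (grid T.mean 0 t) * Zvar) < Zsum (grid T.mean 0 t) \<omega>) +
      \<P>(\<omega> in P. \<eta> * sqrt t < \<bar>V t \<omega> - (ratio * t + Zsum (grid T.mean 0 t) \<omega>)\<bar>) < \<beta>"
    using tendsto_add[OF Zsum_grid_CLT[of z] compound_renewal_approx[OF \<eta>(1)]] assms(2)
    by (intro order_tendstoD(2)) auto
  show ?thesis
    using lim order_tendstoD(2)[OF normal_threshold_tendsto \<eta>(2)] eventually_gt_at_top[of 0]
  proof eventually_elim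
    case (elim t)
    note [measurable] = V_measurable[OF less_imp_le[OF elim(3)]]
    let ?n = "grid T.mean 0 t"
    let ?Bad = "{\<omega> \<in> space P. \<eta> * sqrt t < \<bar>V t \<omega> - (ratio * t + Zsum ?n \<omega>)\<bar>}"
    have thr: "z * sqrt (real ?n * Zvar) < (y - \<eta>) * sqrt t"
      using elim by (simp add: pos_divide_less_eq)
    have "\<P>(\<omega> in P. ratio * t + y * sqrt t < V t \<omega>)
        \<le> prob ({\<omega> \<in> space P. z * sqrt (real ?n * Zvar) < Zsum ?n \<omega>} \<union> ?Bad)"
      by (intro finite_measure_mono, use thr in \<open>auto simp: abs_le_iff not_less left_diff_distrib\<close>)
    also have "\<dots> \<le> \<P>(\<omega> in P. z * sqrt (real ?n * Zvar) < Zsum ?n \<omega>) + prob ?Bad"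
      by (rule measure_Un_le) measurable
    finally show ?case using elim by simp
  qed
qed

section \<open>Strict decrease of the tail\<close>

text \<open>The event of exactly \<open>n\<close> renewals involves only the waiting times
  \<open>T 0\<close> to \<open>T n\<close>, one more than the \<open>n\<close> rewards in the sum,
  and no reward.\<close>

lemma prob_renewal_and_sum:
  "\<P>(\<omega> in P. (T.psum n \<omega> \<le> t \<and> t < T.psum (Suc n) \<omega>) \<and> \<bar>Y.psum n \<omega> - w\<bar> < e)
    = \<P>(\<omega> in P. T.psum n \<omega> \<le> t \<and> t < T.psum (Suc n) \<omega>) * \<P>(\<omega> in P. \<bar>Y.psum n \<omega> - w\<bar> < e)"
proof -
  define g :: "(nat + nat \<Rightarrow> real) \<Rightarrow> real" where
    "g x = (if (\<Sum>i<n. x (Inl i)) \<le> t \<and> t < (\<Sum>i<Suc n. x (Inl i)) then 1 else 0)" for x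
  have g: "g \<in> borel_measurable (PiM (Inl ` {..n}) (\<lambda>_. borel))"
    unfolding g_def by measurable
  have "indep_var borel (g \<circ> (\<lambda>\<omega>. restrict (\<lambda>i. case_sum T Y i \<omega>) (Inl ` {..n})))
    borel ((\<lambda>x. \<Sum>i<n. x (Inr i)) \<circ> (\<lambda>\<omega>. restrict (\<lambda>i. case_sum T Y i \<omega>) (Inr ` {..<n})))"
    by (rule indep_var_compose[OF indep_var_restrict[OF indep_TY] g]) auto
  also have "g \<circ> (\<lambda>\<omega>. restrict (\<lambda>i. case_sum T Y i \<omega>) (Inl ` {..n}))
      = (\<lambda>\<omega>. if T.psum n \<omega> \<le> t \<and> t < T.psum (Suc n) \<omega> then 1 else 0)"
    by (auto simp: g_def fun_eq_iff T.psum_def)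
  also have "(\<lambda>x. \<Sum>i<n. x (Inr i)) \<circ> (\<lambda>\<omega>. restrict (\<lambda>i. case_sum T Y i \<omega>) (Inr ` {..<n})) = Y.psum n"
    by (auto simp: fun_eq_iff Y.psum_def)
  finally have ind: "indep_var borel (\<lambda>\<omega>. if T.psum n \<omega> \<le> t \<and> t < T.psum (Suc n) \<omega> then 1 else 0 :: real)
    borel (Y.psum n)" .
  have "(if b then 1 else 0 :: real) = 1 \<longleftrightarrow> b" for b by simp
  with prob_indep_random_variable[OF ind, of "{1}" "{v. \<bar>v - w\<bar> < e}"] show ?thesis
    by simp
qed

text \<open>The count falls between the two brackets with probability at least \<open>1 / 2\<close>,
  and only finitely many values are available there.\<close>

lemma eventually_renewal_count_charged:
  obtains x where "\<forall>\<^sub>F t in at_top. \<exists>n. grid T.mean (- x) t \<le> n \<and> n \<le> grid T.mean x t \<and>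
    0 < \<P>(\<omega> in P. T.psum n \<omega> \<le> t \<and> t < T.psum (Suc n) \<omega>)"
proof -
  obtain x where x: "0 < x" "\<forall>\<^sub>F t in at_top. \<P>(\<omega> in P. t < T.psum (grid T.mean (- x) t) \<omega> \<or>
      T.psum (grid T.mean x t) \<omega> \<le> t) \<le> 1 / 2"
    using T.eventually_prob_grid_brackets[of "1 / 2"] by auto
  from x(2) have "\<forall>\<^sub>F t in at_top. \<exists>n. grid T.mean (- x) t \<le> n \<and> n \<le> grid T.mean x t \<and>
    0 < \<P>(\<omega> in P. T.psum n \<omega> \<le> t \<and> t < T.psum (Suc n) \<omega>)"
  proof eventually_elim
    case (elim t)
    let ?p = "grid T.mean (- x) t" and ?q = "grid T.mean x t"
    let ?E = "\<lambda>n. {\<omega> \<in> space P. T.psum n \<omega> \<le> t \<and> t < T.psum (Suc n) \<omega>}"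
    have "\<P>(\<omega> in P. \<not> (t < T.psum ?p \<omega> \<or> T.psum ?q \<omega> \<le> t)) \<le> prob (\<Union>n\<in>{?p..?q}. ?E n)"
    proof (intro finite_measure_mono subsetI)
      fix \<omega> assume "\<omega> \<in> {\<omega> \<in> space P. \<not> (t < T.psum ?p \<omega> \<or> T.psum ?q \<omega> \<le> t)}"
      then have \<omega>: "\<omega> \<in> space P" "T.psum ?p \<omega> \<le> t" "t < T.psum ?q \<omega>" by auto
      have "?p \<le> ?q"
        using T.psum_mono[OF \<omega>(1), of ?q ?p] \<omega> by (meson le_less_trans not_le order_less_irrefl nat_le_linear order_trans)
      then obtain k where "k < ?q - ?p" "T.psum (?p + k) \<omega> \<le> t" "\<not> T.psum (?p + Suc k) \<omega> \<le> t"
        using nat_exists_switch[of "\<lambda>k. T.psum (?p + k) \<omega> \<le> t" "?q - ?p"] \<omega> by auto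
      then show "\<omega> \<in> (\<Union>n\<in>{?p..?q}. ?E n)"
        using \<omega>(1) by (auto intro!: bexI[of _ "?p + k"])
    qed measurable
    also have "\<dots> \<le> (\<Sum>n\<in>{?p..?q}. prob (?E n))"
      by (intro finite_measure_subadditive_finite) auto
    finally have "0 < (\<Sum>n\<in>{?p..?q}. prob (?E n))"
      using elim prob_neg[of "\<lambda>\<omega>. t < T.psum ?p \<omega> \<or> T.psum ?q \<omega> \<le> t"] by auto
    then have "\<exists>n\<in>{?p..?q}. 0 < prob (?E n)"
      by (meson sum_nonpos not_le)
    then show ?case by auto
  qed
  then show thesis by (rule that)
qed

text \<open>Fix a count \<open>n\<close> of positive probability. Given that count,
  \<open>V t\<close> is an independent reward sum, whose law charges every interval in the window
  because \<open>n * c\<close> and \<open>n * d\<close> lie linearly far below and above it.\<close>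

lemma eventually_tail_strict:
  "\<forall>\<^sub>F t in at_top. \<forall>u v. ratio * t + l * sqrt t \<le> u \<longrightarrow> u < v \<longrightarrow> v \<le> ratio * t + h * sqrt t \<longrightarrow>
    \<P>(\<omega> in P. v < V t \<omega>) < \<P>(\<omega> in P. u < V t \<omega>)"
proof -
  obtain c d x0 k where cd: "0 \<le> c" "c < Y.mean" "Y.mean < d"
    and cover: "\<And>n u e. real n * c + x0 \<le> u \<Longrightarrow> u \<le> real n * d + x0 \<Longrightarrow> 0 < e \<Longrightarrow>
      0 < \<P>(\<omega> in P. \<bar>Y.psum (n + k) \<omega> - u\<bar> < e)"
    by (rule Y.psum_covers) (rule that)
  obtain x where x: "\<forall>\<^sub>F t in at_top. \<exists>n. grid T.mean (- x) t \<le> n \<and> n \<le> grid T.mean x t \<and>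
    0 < \<P>(\<omega> in P. T.psum n \<omega> \<le> t \<and> t < T.psum (Suc n) \<omega>)"
    using eventually_renewal_count_charged .
  \<comment> \<open>These slopes make terms linear in \<open>t\<close> dominate those in
    \<open>sqrt t\<close>: the first ensures \<open>n \<ge> k\<close>, the other two push the ends
    of the covered interval past the window.\<close>
  have pos: "0 < 1 / T.mean" "0 < (Y.mean - c) / T.mean" "0 < (d - Y.mean) / T.mean"
    using cd T.mean_pos by auto
  show ?thesis
    using x eventually_grid_bounds[OF T.mean_pos, of x] eventually_grid_bounds[OF T.mean_pos, of "- x"]
      eventually_sqrt_bound[OF pos(1), of x "1 + real k"]
      eventually_sqrt_bound[OF pos(2), of "x * c - l" x0]
      eventually_sqrt_bound[OF pos(3), of "h + x * d" "(1 + real k) * d - x0"]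
      eventually_gt_at_top[of 0]
  proof eventually_elim
    case (elim t)
    note [measurable] = V_measurable[OF less_imp_le[OF elim(7)]]
    let ?p = "grid T.mean (- x) t" and ?q = "grid T.mean x t"
    obtain n where n: "?p \<le> n" "n \<le> ?q" "0 < \<P>(\<omega> in P. T.psum n \<omega> \<le> t \<and> t < T.psum (Suc n) \<omega>)"
      using elim(1) by blast
    have r: "ratio * t = Y.mean / T.mean * t" by (simp add: ratio_def)
    have "real k \<le> real ?p" using elim(3,4) by simp
    then have "k \<le> n" using n(1) by simp
    then obtain j where j: "n = j + k" by (metis le_add_diff_inverse2)
    have "real n \<le> t / T.mean + x * sqrt t" using n(2) elim(2) by simp
    from mult_right_mono[OF this cd(1)]
    have "real n * c \<le> (t / T.mean + x * sqrt t) * c" .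
    moreover have "real j * c \<le> real n * c" using cd(1) j by (intro mult_right_mono) auto
    ultimately have lo: "real j * c + x0 \<le> ratio * t + l * sqrt t"
      using elim(5) unfolding r by (simp add: algebra_simps diff_divide_distrib)
    have "t / T.mean - x * sqrt t - 1 - real k \<le> real j"
      using n(1) elim(3) j by simp
    from mult_right_mono[OF this, of d] cd Y.mean_pos
    have "(t / T.mean - x * sqrt t - 1 - real k) * d \<le> real j * d" by simp
    then have hi: "ratio * t + h * sqrt t \<le> real j * d + x0"
      using elim(6) unfolding r by (simp add: algebra_simps diff_divide_distrib)
    show ?case
    proof (intro allI impI)
      fix u v assume uv: "ratio * t + l * sqrt t \<le> u" "u < v" "v \<le> ratio * t + h * sqrt t"
      \<comment> \<open>Midpoint and radius of the open interval from \<open>u\<close> to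
        \<open>v\<close>; on \<open>?E\<close> the value \<open>V t\<close> lies in it, so
        \<open>?E\<close> is lost in passing from \<open>u\<close> to \<open>v\<close>.\<close>
      let ?w = "(u + v) / 2" and ?e = "(v - u) / 2"
      let ?E = "{\<omega> \<in> space P. (T.psum n \<omega> \<le> t \<and> t < T.psum (Suc n) \<omega>) \<and> \<bar>Y.psum n \<omega> - ?w\<bar> < ?e}"
      have "0 < \<P>(\<omega> in P. \<bar>Y.psum (j + k) \<omega> - ?w\<bar> < ?e)"
        using order_trans[OF lo uv(1)] order_trans[OF uv(3) hi] uv(2) by (intro cover) auto
      then have "0 < \<P>(\<omega> in P. \<bar>Y.psum n \<omega> - ?w\<bar> < ?e)" using j by simp
      with n(3) have "0 < prob ?E" by (simp only: prob_renewal_and_sum mult_pos_pos)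
      moreover have "prob ({\<omega> \<in> space P. v < V t \<omega>} \<union> ?E) = \<P>(\<omega> in P. v < V t \<omega>) + prob ?E"
      proof (intro finite_measure_Union)
        have "V t \<omega> = Y.psum n \<omega>" if "\<omega> \<in> ?E" for \<omega>
          using that elim(7) renewal_count_eqI[of \<omega> t n] by (simp add: V_eq)
        then show "{\<omega> \<in> space P. v < V t \<omega>} \<inter> ?E = {}" by (auto simp: abs_less_iff field_simps)
      qed measurable
      moreover have "prob ({\<omega> \<in> space P. v < V t \<omega>} \<union> ?E) \<le> \<P>(\<omega> in P. u < V t \<omega>)"
      proof (intro finite_measure_mono)
        have "V t \<omega> = Y.psum n \<omega>" if "\<omega> \<in> ?E" for \<omega>
          using that elim(7) renewal_count_eqI[of \<omega> t n] by (simp add: V_eq)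
        then show "{\<omega> \<in> space P. v < V t \<omega>} \<union> ?E \<subseteq> {\<omega> \<in> space P. u < V t \<omega>}"
          using uv(2) by (auto simp: abs_less_iff field_simps)
      qed measurable
      ultimately show "\<P>(\<omega> in P. v < V t \<omega>) < \<P>(\<omega> in P. u < V t \<omega>)" by linarith
    qed
  qed
qed

section \<open>The level and its limit\<close>

lemma eventually_fixed_prob_level_bounds:
  assumes \<alpha>: "0 < \<alpha>" "\<alpha> < 1"
    and l: "l < sdev * upper_normal_quantile \<alpha>" and h: "sdev * upper_normal_quantile \<alpha> < h"
  shows "\<forall>\<^sub>F t in at_top. ratio * t + l * sqrt t < fixed_prob_level P T Y \<alpha> t 0 \<and>
    fixed_prob_level P T Y \<alpha> t 0 < ratio * t + h * sqrt t"
proof -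
  let ?\<kappa> = "upper_normal_quantile \<alpha>" and ?F = "cdf std_normal_distribution"
  have F: "1 - ?F ?\<kappa> = \<alpha>" by (rule upper_normal_quantile_works[OF \<alpha>])
  have "l / sdev < ?\<kappa>" "?\<kappa> < h / sdev"
    using l h sdev_pos by (auto simp: field_simps)
  \<comment> \<open>Intermediate points leave strict room on both sides: against \<open>l\<close>
    and \<open>h\<close> for the thresholds, and against the quantile for the tail values.\<close>
  then obtain y z where y: "l / sdev < y" "y < ?\<kappa>" and z: "?\<kappa> < z" "z < h / sdev"
    using dense by meson
  have "l < sdev * y" "sdev * z < h" using y z sdev_pos by (auto simp: field_simps)
  moreover have "\<alpha> < 1 - ?F y" "1 - ?F z < \<alpha>"
    using strict_monoD[OF cdf_std_normal_strict_mono] y(2) z(1) F by fastforce+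
  ultimately have tails: "\<forall>\<^sub>F t in at_top. \<alpha> < \<P>(\<omega> in P. ratio * t + l * sqrt t < V t \<omega>)"
    "\<forall>\<^sub>F t in at_top. \<P>(\<omega> in P. ratio * t + h * sqrt t < V t \<omega>) < \<alpha>"
    using eventually_tail_gt eventually_tail_less by blast+
  show ?thesis
    using tails eventually_tail_strict[of l h] eventually_sqrt_bound[OF ratio_pos, of "- l" 0]
      eventually_gt_at_top[of 0]
  proof eventually_elim
    case (elim t)
    let ?G = "\<lambda>u. \<P>(\<omega> in P. u < V t \<omega>)"
    have t: "0 \<le> t" using elim by simp
    have bounds: "ratio * t + l * sqrt t < u \<and> u < ratio * t + h * sqrt t" if "?G u = \<alpha>" for u
      using that elim(1,2) tail_antimono[OF t, of u "ratio * t + l * sqrt t"]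
        tail_antimono[OF t, of "ratio * t + h * sqrt t" u] by (meson leD le_less_linear less_le_trans)
    have "\<alpha> \<le> ?G 0"
      using elim(1,4) tail_antimono[OF t, of 0 "ratio * t + l * sqrt t"] by simp
    then obtain u where u: "0 \<le> u" "?G u = \<alpha>"
      using tail_attains[OF t \<alpha>(1)] by blast
    \<comment> \<open>All solutions lie in the window where the tail is strictly decreasing, so two
      of them must coincide.\<close>
    have unique: "v = u" if "?G v = \<alpha>" for v
      using elim(3)[rule_format, of u v] elim(3)[rule_format, of v u] bounds[OF that] bounds[OF u(2)]
        that u(2) by (cases u v rule: linorder_cases) auto
    have "(THE u. 0 \<le> u \<and> ?G u = \<alpha>) = u"
      by (rule the_equality) (use u unique in blast)+
    then have "fixed_prob_level P T Y \<alpha> t 0 = u"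
      unfolding fixed_prob_level_def prob_ruin_time_le[OF elim(5)] .
    with bounds[OF u(2)] show ?case by simp
  qed
qed

lemma fixed_prob_level_tendsto:
  assumes "0 < \<alpha>" "\<alpha> < 1"
  shows "((\<lambda>t. (fixed_prob_level P T Y \<alpha> t 0 - ratio * t) / sqrt t)
    \<longlongrightarrow> sdev * upper_normal_quantile \<alpha>) at_top"
proof (rule order_tendstoI)
  fix l assume "l < sdev * upper_normal_quantile \<alpha>"
  from eventually_fixed_prob_level_bounds[OF assms this less_add_one] eventually_gt_at_top[of 0]
  show "\<forall>\<^sub>F t in at_top. l < (fixed_prob_level P T Y \<alpha> t 0 - ratio * t) / sqrt t"
    by eventually_elim (simp add: pos_less_divide_eq algebra_simps)
next
  fix h assume "sdev * upper_normal_quantile \<alpha> < h"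
  moreover have "sdev * upper_normal_quantile \<alpha> - 1 < sdev * upper_normal_quantile \<alpha>" by simp
  ultimately show "\<forall>\<^sub>F t in at_top. (fixed_prob_level P T Y \<alpha> t 0 - ratio * t) / sqrt t < h"
    using eventually_fixed_prob_level_bounds[OF assms, of _ h] eventually_gt_at_top[of 0]
    by (smt (verit) eventually_elim2 pos_divide_less_eq real_sqrt_gt_zero)
qed

end

section \<open>The expansion in terms of the original constants\<close>

theorem theorem6p1:
  fixes P :: "'a measure"
    and T Y :: "nat \<Rightarrow> 'a \<Rightarrow> real"
    and f\<^sub>T f\<^sub>Y :: "real \<Rightarrow> real"
    and \<alpha> :: real
  assumes "prob_space P"
    and "prob_space.indep_vars P (\<lambda>_. borel) (case_sum T Y) UNIV"
    and "\<And>i \<omega>. \<omega> \<in> space P \<Longrightarrow> 0 < T i \<omega>"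
    and "\<And>i \<omega>. \<omega> \<in> space P \<Longrightarrow> 0 < Y i \<omega>"
    and "\<And>x. 0 \<le> f\<^sub>T x"
    and "\<And>x. 0 \<le> f\<^sub>Y x"
    and "\<And>i. distributed P lborel (T i) (\<lambda>x. ennreal (f\<^sub>T x))"
    and "\<And>i. distributed P lborel (Y i) (\<lambda>x. ennreal (f\<^sub>Y x))"
    and "0 < \<alpha>" and "\<alpha> < 1 / 2"
    and "\<exists>C. \<forall>x. f\<^sub>T x \<le> C"
    and "\<exists>C. \<forall>x. f\<^sub>Y x \<le> C"
    and "D_squared P (T 0) (Y 0) > 0"
    and "integrable P (\<lambda>\<omega>. T 0 \<omega> ^ 3)"
    and "integrable P (\<lambda>\<omega>. Y 0 \<omega> ^ 3)"
  shows "\<exists>\<epsilon> \<in> o[at_top](\<lambda>_. 1 :: real). \<forall>\<^sub>F t in at_top.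
           fixed_prob_level P T Y \<alpha> t 0 =
             t / mean_ratio P (T 0) (Y 0)
             + sqrt (D_squared P (T 0) (Y 0)) / mean_ratio P (T 0) (Y 0) powr (3 / 2)
               * upper_normal_quantile \<alpha> * sqrt t * (1 + \<epsilon> t)"
proof -
  interpret prob_space P by fact
  \<comment> \<open>Third moments give the second moments assumed in the locale.\<close>
  have square: "integrable P (\<lambda>\<omega>. (X \<omega>)\<^sup>2)"
    if X: "random_variable borel X" "integrable P (\<lambda>\<omega>. X \<omega> ^ 3)" for X :: "'a \<Rightarrow> real"
  proof (rule Bochner_Integration.integrable_bound)
    show "integrable P (\<lambda>\<omega>. 1 + \<bar>X \<omega> ^ 3\<bar>)"
      using X(2) by (intro Bochner_Integration.integrable_add integrable_abs) auto
    have "x\<^sup>2 \<le> 1 + \<bar>x ^ 3\<bar>" for x :: real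
    proof (cases "\<bar>x\<bar> \<le> 1")
      case True
      then have "x\<^sup>2 \<le> 1" by (simp add: abs_square_le_1)
      then show ?thesis by simp
    next
      case False
      then have "\<bar>x\<bar> ^ 2 \<le> \<bar>x\<bar> ^ 3" by (intro power_increasing) auto
      then show ?thesis by (simp add: power_abs)
    qed
    then show "AE \<omega> in P. norm ((X \<omega>)\<^sup>2) \<le> norm (1 + \<bar>X \<omega> ^ 3\<bar>)" by simp
    show "random_variable borel (\<lambda>\<omega>. (X \<omega>)\<^sup>2)" using X(1) by measurable
  qed
  have rv: "random_variable borel (T 0)" "random_variable borel (Y 0)"
    using assms(7,8)[of 0] by (auto dest: distributed_measurable)
  interpret renewal_reward P T Y "\<lambda>x. ennreal (f\<^sub>T x)" "\<lambda>x. ennreal (f\<^sub>Y x)"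
    using assms rv by unfold_locales (auto intro: square)
  let ?u = "\<lambda>t. fixed_prob_level P T Y \<alpha> t 0" and ?\<kappa> = "upper_normal_quantile \<alpha>"
  define c where "c = sdev * ?\<kappa>"
  have c: "0 < c"
    using sdev_pos upper_normal_quantile_pos assms(9,10) by (simp add: c_def)
  have M: "mean_ratio P (T 0) (Y 0) = T.mean / Y.mean"
    by (simp add: mean_ratio_def T.mean_def Y.mean_def)
  have D: "D_squared P (T 0) (Y 0) = T.mean\<^sup>2 * Zvar / Y.mean ^ 3"
  proof -
    have "D_squared P (T 0) (Y 0) = (T.mean\<^sup>2 * Y.var + Y.mean\<^sup>2 * T.var) / Y.mean ^ 3"
      by (simp only: D_squared_def T.mean_def Y.mean_def T.var_def Y.var_def)
    then show ?thesis
      using T.mean_pos by (simp add: Zvar_def ratio_def distrib_left power_divide)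
  qed
  have coeff: "sqrt (D_squared P (T 0) (Y 0)) / mean_ratio P (T 0) (Y 0) powr (3 / 2) = sdev"
  proof -
    let ?M = "T.mean / Y.mean"
    have "?M powr (3 / 2) = sqrt (?M ^ 3)"
      using T.mean_pos Y.mean_pos by (simp add: powr_half_sqrt[symmetric] powr_powr flip: powr_numeral)
    moreover have "T.mean\<^sup>2 * Zvar / Y.mean ^ 3 / ?M ^ 3 = Zvar / T.mean"
      using T.mean_pos Y.mean_pos by (simp add: field_simps power2_eq_square power3_eq_cube)
    ultimately show ?thesis
      by (simp add: M D sdev_def flip: real_sqrt_divide)
  qed
  \<comment> \<open>Obtained by solving the claimed equation for the relative error; dividing by
    \<open>c\<close> is legitimate since the quantile is positive.\<close>
  let ?\<epsilon> = "\<lambda>t. (?u t - ratio * t) / sqrt t / c - 1"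
  have "((\<lambda>t. (?u t - ratio * t) / sqrt t / c - 1) \<longlongrightarrow> c / c - 1) at_top"
    using fixed_prob_level_tendsto[of \<alpha>] assms(9,10) c
    by (intro tendsto_intros) (auto simp: c_def)
  then have "?\<epsilon> \<in> o[at_top](\<lambda>_. 1)"
    using c by (intro smalloI_tendsto) auto
  moreover have "\<forall>\<^sub>F t in at_top. ?u t = t / mean_ratio P (T 0) (Y 0)
      + sqrt (D_squared P (T 0) (Y 0)) / mean_ratio P (T 0) (Y 0) powr (3 / 2) * ?\<kappa> * sqrt t * (1 + ?\<epsilon> t)"
    using eventually_gt_at_top[of 0]
  proof eventually_elim
    case (elim t)
    have "c * sqrt t * (1 + ?\<epsilon> t) = ?u t - ratio * t"
      using elim c by simp
    moreover have "t / mean_ratio P (T 0) (Y 0) = ratio * t"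
      by (simp add: M ratio_def)
    ultimately show ?case
      unfolding coeff c_def[symmetric] by simp
  qed
  ultimately show ?thesis by (intro bexI[of _ ?\<epsilon>])
qed

end
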